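(* Let $k\ge 1$ be an integer. The class of inversion-free proper $k$-mixed-thin graphs is a transduction of the class of posets of width at most $5\cdot\binom{k}{2}+2k$. Moreover, for a given inversion-free proper $k$-mixed-thin graph $G$, together with a vertex partition and linear orders witnessing that $G$ is inversion-free proper $k$-mixed-thin, a corresponding poset of width at most $5\cdot\binom{k}{2}+2k$ and its transduction parameters (the marks on the poset from which the transduction outputs $G$) can be computed in polynomial time.
   Context: Graphs are finite and simple. **Inversion-free proper $k$-mixed-thin.** Let $G=(V,E)$ be a graph, $k>0$ an integer, and $\bar E=\binom{V}{2}\setminus E$. $G$ is *inversion-free proper $k$-mixed-thin* if there exist a partition $(V_1,\ldots,V_k)$ of $V$ and, for each $1\le i\le j\le k$, a linear order $\le_{ij}$ on $V_i\cup V_j$ and a choice of $E_{i,j}\in\{E,\bar E\}$ such that for every $1\le i\le j\le k$ (writing $\lneq_{ij}$ for the strict order): (a') the restriction of $\le_{ij}$ to $V_i$ (resp. to $V_j$) is equal to $\le_{ii}$ (resp. $\le_{jj}$); (b) for every triple $u,v,w$ such that ($\{u,v\}\subseteq V_i$ and $w\in V_j$) or ($\{u,v\}\subseteq V_j$ and $w\in V_i$): if $u\lneq_{ij}v\lneq_{ij}w$ and $uw\in E_{i,j}$, then $vw\in E_{i,j}$; (c) for every triple $u,v,w$ such that ($\{v,w\}\subseteq V_i$ and $u\in V_j$) or ($\{v,w\}\subseteq V_j$ and $u\in V_i$): if $u\lneq_{ij}v\lneq_{ij}w$ and $uw\in E_{i,j}$, then $uv\in E_{i,j}$. **Posets.**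 The *width* of a poset is the maximum size of an antichain in it. Posets are viewed as relational structures with one binary relation (the order), graphs as relational structures on the vertex set with one binary relation (adjacency). **Transductions.** For (finite) relational signatures $\Sigma,\Gamma$, an *interpretation* $I$ of $\Gamma$-structures in $\Sigma$-structures is given by a first-order formula $\varphi_0(x)$ and a first-order formula $\varphi_R(x_1,\dots,x_m)$ for each $R\in\Gamma$ of arity $m$, all over $\Sigma$; for a $\Sigma$-structure $\boldsymbol{A}$ with domain $A$, $I(\boldsymbol{A})$ is the $\Gamma$-structure with domain $B=\{a\in A: \boldsymbol{A}\models\varphi_0(a)\}$ in which $R$ is interpreted as the set of tuples of $B^m$ satisfying $\varphi_R$ in $\boldsymbol{A}$. A (non-copying) *transduction* $T$ from $\Sigma$-structures to $\Gamma$-structures is defined by an interpretation $I_T$ of $\Gamma$-structures in $\Sigma^+$-structures, where $\Sigma^+$ is $\Sigma$ extended by finitely many unary relational symbols ( *marks* ); $T(\boldsymbol{A})$ is the set of all $I_T(\boldsymbol{A}')$ where $\boldsymbol{A}'$ is $\boldsymbol{A}$ with arbitrary elements marked by the marks. For a class $\mathcal{C}$, $T(\mathcal{C})=\bigcup_{\boldsymbol{A}\in\mathcal{C}}T(\boldsymbol{A})$. A class $\mathcal{D}$ is *a transduction of* $\mathcal{C}$ if there is a transduction $T$ with $\mathcal{D}\subseteq T(\mathcal{C})$. The graph $G$ and a poset $P$ correspond if $G\in T(P)$ for the fixed transduction $T$ (depending only on $k$). *)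

theory Defs
  imports
    "HOL-Library.Ramsey"
    "HOL-Library.Infinite_Typeclass"
    "HOL-Library.Disjoint_Sets"
    "HOL-Computational_Algebra.Polynomial"
begin

section \<open>Relational structures and first-order logic\<close>

text \<open>
  A signature maps each of its symbols to the arity; \<^term>\<open>None\<close> means that the symbol does not
  belong to the signature.  A structure interprets every symbol as a set of tuples (lists), with
  the empty set for symbols outside the signature, so that equality of structures is equality in
  the mathematical sense.
\<close>

type_synonym 'r signature = "'r \<Rightarrow> nat option"

record ('r, 'a) rel_structure =
  universe :: "'a set"
  interp :: "'r \<Rightarrow> 'a list set"

definition structure_over :: "'r signature \<Rightarrow> ('r, 'a) rel_structure \<Rightarrow> bool" where
  "structure_over \<Sigma> \<AA> \<longleftrightarrow>
     (\<forall>r. interp \<AA> r \<subseteq> {xs. set xs \<subseteq> universe \<AA> \<and> \<Sigma> r = Some (length xs)})"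

datatype 'r formula =
    Eq nat nat
  | Rel 'r "nat list"
  | Neg "'r formula"
  | Conj "'r formula" "'r formula"
  | Exi nat "'r formula"

primrec sat :: "('r, 'a) rel_structure \<Rightarrow> (nat \<Rightarrow> 'a) \<Rightarrow> 'r formula \<Rightarrow> bool" where
  "sat \<AA> e (Eq x y) \<longleftrightarrow> e x = e y"
| "sat \<AA> e (Rel r xs) \<longleftrightarrow> map e xs \<in> interp \<AA> r"
| "sat \<AA> e (Neg \<phi>) \<longleftrightarrow> \<not> sat \<AA> e \<phi>"
| "sat \<AA> e (Conj \<phi> \<psi>) \<longleftrightarrow> sat \<AA> e \<phi> \<and> sat \<AA> e \<psi>"
| "sat \<AA> e (Exi x \<phi>) \<longleftrightarrow> (\<exists>a \<in> universe \<AA>. sat \<AA> (e(x := a)) \<phi>)"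

primrec free_vars :: "'r formula \<Rightarrow> nat set" where
  "free_vars (Eq x y) = {x, y}"
| "free_vars (Rel r xs) = set xs"
| "free_vars (Neg \<phi>) = free_vars \<phi>"
| "free_vars (Conj \<phi> \<psi>) = free_vars \<phi> \<union> free_vars \<psi>"
| "free_vars (Exi x \<phi>) = free_vars \<phi> - {x}"

primrec formula_over :: "'r signature \<Rightarrow> 'r formula \<Rightarrow> bool" where
  "formula_over \<Sigma> (Eq x y) \<longleftrightarrow> True"
| "formula_over \<Sigma> (Rel r xs) \<longleftrightarrow> \<Sigma> r = Some (length xs)"
| "formula_over \<Sigma> (Neg \<phi>) \<longleftrightarrow> formula_over \<Sigma> \<phi>"
| "formula_over \<Sigma> (Conj \<phi> \<psi>) \<longleftrightarrow> formula_over \<Sigma> \<phi> \<and> formula_over \<Sigma> \<psi>"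
| "formula_over \<Sigma> (Exi x \<phi>) \<longleftrightarrow> formula_over \<Sigma> \<phi>"


section \<open>Interpretations and transductions\<close>

text \<open>
  The free variable of the domain formula is \<open>0\<close>; the free variables \<open>x\<^sub>1, \<dots>, x\<^sub>m\<close> of the
  formula for an \<open>m\<close>-ary symbol are \<open>0, \<dots>, m - 1\<close>.
\<close>

record ('s, 'r) interpretation_scheme =
  dom_formula :: "'s formula"
  rel_formula :: "'r \<Rightarrow> 's formula"

definition is_interpretation ::
  "'s signature \<Rightarrow> 'r signature \<Rightarrow> ('s, 'r) interpretation_scheme \<Rightarrow> bool" where
  "is_interpretation \<Sigma> \<Gamma> I \<longleftrightarrow>
     formula_over \<Sigma> (dom_formula I) \<and> free_vars (dom_formula I) \<subseteq> {0} \<and>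
     (\<forall>r m. \<Gamma> r = Some m \<longrightarrow>
        formula_over \<Sigma> (rel_formula I r) \<and> free_vars (rel_formula I r) \<subseteq> {..<m})"

definition interpreted_universe ::
  "('s, 'r) interpretation_scheme \<Rightarrow> ('s, 'a) rel_structure \<Rightarrow> 'a set" where
  "interpreted_universe I \<AA> = {a \<in> universe \<AA>. sat \<AA> (\<lambda>_. a) (dom_formula I)}"

definition apply_scheme ::
  "'r signature \<Rightarrow> ('s, 'r) interpretation_scheme \<Rightarrow> ('s, 'a) rel_structure \<Rightarrow> ('r, 'a) rel_structure" where
  "apply_scheme \<Gamma> I \<AA> =
     \<lparr>universe = interpreted_universe I \<AA>,
      interp = (\<lambda>r. {xs. set xs \<subseteq> interpreted_universe I \<AA> \<and> \<Gamma> r = Some (length xs) \<and>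
                         sat \<AA> (\<lambda>i. xs ! i) (rel_formula I r)})\<rparr>"

text \<open>
  \<open>\<Sigma>\<^sup>+\<close>: the symbols of \<open>\<Sigma>\<close> together with \<open>q\<close> unary marks \<open>Inr 0, \<dots>, Inr (q - 1)\<close>.
\<close>

definition marked_signature :: "nat \<Rightarrow> 'r signature \<Rightarrow> ('r + nat) signature" where
  "marked_signature q \<Sigma> = case_sum \<Sigma> (\<lambda>i. if i < q then Some 1 else None)"

definition mark_structure ::
  "nat \<Rightarrow> (nat \<Rightarrow> 'a set) \<Rightarrow> ('r, 'a) rel_structure \<Rightarrow> ('r + nat, 'a) rel_structure" where
  "mark_structure q M \<AA> =
     \<lparr>universe = universe \<AA>,
      interp = case_sum (interp \<AA>) (\<lambda>i. if i < q then {[a] | a. a \<in> M i} else {})\<rparr>"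

record ('s, 'r) transduction =
  num_marks :: nat
  scheme :: "('s + nat, 'r) interpretation_scheme"

definition is_transduction ::
  "'s signature \<Rightarrow> 'r signature \<Rightarrow> ('s, 'r) transduction \<Rightarrow> bool" where
  "is_transduction \<Sigma> \<Gamma> T \<longleftrightarrow>
     finite {r. \<Sigma> r \<noteq> None} \<and> finite {r. \<Gamma> r \<noteq> None} \<and>
     is_interpretation (marked_signature (num_marks T) \<Sigma>) \<Gamma> (scheme T)"

definition is_marking ::
  "('s, 'r) transduction \<Rightarrow> ('s, 'a) rel_structure \<Rightarrow> (nat \<Rightarrow> 'a set) \<Rightarrow> bool" where
  "is_marking T \<AA> M \<longleftrightarrow> (\<forall>i < num_marks T. M i \<subseteq> universe \<AA>)"

definition transduce_marked ::
  "'r signature \<Rightarrow> ('s, 'r) transduction \<Rightarrow> ('s, 'a) rel_structure \<Rightarrow> (nat \<Rightarrow> 'a set)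
     \<Rightarrow> ('r, 'a) rel_structure" where
  "transduce_marked \<Gamma> T \<AA> M = apply_scheme \<Gamma> (scheme T) (mark_structure (num_marks T) M \<AA>)"

definition transduce ::
  "'r signature \<Rightarrow> ('s, 'r) transduction \<Rightarrow> ('s, 'a) rel_structure \<Rightarrow> ('r, 'a) rel_structure set" where
  "transduce \<Gamma> T \<AA> = {transduce_marked \<Gamma> T \<AA> M | M. is_marking T \<AA> M}"

text \<open>
  The members of both classes have their elements in the same type.  Since the result of a
  non-copying transduction lives on a subset of the domain of its argument, this type should be
  infinite for classes of finite structures.
\<close>

definition transduce_class ::
  "'r signature \<Rightarrow> ('s, 'r) transduction \<Rightarrow> ('s, 'a) rel_structure set \<Rightarrow> ('r, 'a) rel_structure set" where
  "transduce_class \<Gamma> T \<C> = (\<Union>\<AA> \<in> \<C>. transduce \<Gamma> T \<AA>)"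


lemma structure_over_mark_structure:
  assumes "structure_over \<Sigma> \<AA>" and "is_marking T \<AA> M"
  shows "structure_over (marked_signature (num_marks T) \<Sigma>) (mark_structure (num_marks T) M \<AA>)"
  using assms
  by (fastforce simp: structure_over_def is_marking_def mark_structure_def marked_signature_def
      split: sum.splits)

lemma structure_over_transduce_marked: "structure_over \<Gamma> (transduce_marked \<Gamma> T \<AA> M)"
  by (auto simp: structure_over_def transduce_marked_def apply_scheme_def)


section \<open>Graphs and posets\<close>

definition simple_graph :: "'a set \<Rightarrow> 'a set set \<Rightarrow> bool" where
  "simple_graph V E \<longleftrightarrow> finite V \<and> E \<subseteq> [V]\<^bsup>2\<^esup>"

definition binary_signature :: "unit signature" where
  "binary_signature = (\<lambda>_. Some 2)"

definition graph_structure :: "'a set \<Rightarrow> 'a set set \<Rightarrow> (unit, 'a) rel_structure" where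
  "graph_structure V E =
     \<lparr>universe = V, interp = (\<lambda>_. {[u, v] | u v. u \<in> V \<and> v \<in> V \<and> {u, v} \<in> E})\<rparr>"

definition poset_structure :: "'a set \<Rightarrow> 'a rel \<Rightarrow> (unit, 'a) rel_structure" where
  "poset_structure A r =
     \<lparr>universe = A, interp = (\<lambda>_. {[a, b] | a b. a \<in> A \<and> b \<in> A \<and> (a, b) \<in> r})\<rparr>"

lemma structure_over_graph_structure: "structure_over binary_signature (graph_structure V E)"
  by (auto simp: structure_over_def binary_signature_def graph_structure_def)

lemma structure_over_poset_structure: "structure_over binary_signature (poset_structure A r)"
  by (auto simp: structure_over_def binary_signature_def poset_structure_def)

definition finite_poset :: "'a set \<Rightarrow> 'a rel \<Rightarrow> bool" where
  "finite_poset A r \<longleftrightarrow> finite A \<and> partial_order_on A r"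

definition antichain_in :: "'a set \<Rightarrow> 'a rel \<Rightarrow> 'a set \<Rightarrow> bool" where
  "antichain_in A r X \<longleftrightarrow> X \<subseteq> A \<and> (\<forall>a \<in> X. \<forall>b \<in> X. a \<noteq> b \<longrightarrow> (a, b) \<notin> r)"

definition poset_width :: "'a set \<Rightarrow> 'a rel \<Rightarrow> nat" where
  "poset_width A r = Max {card X | X. antichain_in A r X}"

definition posets_of_width_at_most :: "nat \<Rightarrow> (unit, 'a) rel_structure set" where
  "posets_of_width_at_most w =
     {poset_structure A r | A r. finite_poset A r \<and> poset_width A r \<le> w}"


section \<open>Inversion-free proper mixed-thin graphs\<close>

text \<open>
  The parts \<open>P 1, \<dots>, P k\<close> may be empty.  Only the orders \<open>L i j\<close> with \<open>1 \<le> i \<le> j \<le> k\<close>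
  are relevant; \<open>(u, v) \<in> L i j\<close> means that \<open>u\<close> is below or equal to \<open>v\<close>.
\<close>

definition mixed_thin_witness ::
  "nat \<Rightarrow> 'a set \<Rightarrow> 'a set set \<Rightarrow> (nat \<Rightarrow> 'a set) \<Rightarrow> (nat \<Rightarrow> nat \<Rightarrow> 'a rel) \<Rightarrow> bool" where
  "mixed_thin_witness k V E P L \<longleftrightarrow>
     (\<Union>i \<in> {1..k}. P i) = V \<and> disjoint_family_on P {1..k} \<and>
     (\<forall>i j. 1 \<le> i \<and> i \<le> j \<and> j \<le> k \<longrightarrow> linear_order_on (P i \<union> P j) (L i j)) \<and>
     (\<exists>F. \<forall>i j. 1 \<le> i \<and> i \<le> j \<and> j \<le> k \<longrightarrow>
        F i j \<in> {E, [V]\<^bsup>2\<^esup> - E} \<and>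
        L i j \<inter> (P i \<times> P i) = L i i \<and> L i j \<inter> (P j \<times> P j) = L j j \<and>
        (\<forall>u v w. (({u, v} \<subseteq> P i \<and> w \<in> P j) \<or> ({u, v} \<subseteq> P j \<and> w \<in> P i)) \<and>
           u \<noteq> v \<and> (u, v) \<in> L i j \<and> v \<noteq> w \<and> (v, w) \<in> L i j \<and> {u, w} \<in> F i j
           \<longrightarrow> {v, w} \<in> F i j) \<and>
        (\<forall>u v w. (({v, w} \<subseteq> P i \<and> u \<in> P j) \<or> ({v, w} \<subseteq> P j \<and> u \<in> P i)) \<and>
           u \<noteq> v \<and> (u, v) \<in> L i j \<and> v \<noteq> w \<and> (v, w) \<in> L i j \<and> {u, w} \<in> F i j
           \<longrightarrow> {u, v} \<in> F i j))"

definition inversion_free_proper_mixed_thin :: "nat \<Rightarrow> 'a set \<Rightarrow> 'a set set \<Rightarrow> bool" where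
  "inversion_free_proper_mixed_thin k V E \<longleftrightarrow>
     simple_graph V E \<and> (\<exists>P L. mixed_thin_witness k V E P L)"

definition mixed_thin_graphs :: "nat \<Rightarrow> (unit, 'a) rel_structure set" where
  "mixed_thin_graphs k =
     {graph_structure V E | V E. inversion_free_proper_mixed_thin k V E}"


section \<open>Polynomial-time computability\<close>

text \<open>
  The model is a random access machine, presented as a structured language, with registers and
  indirectly addressed memory cells holding natural numbers, and with addition, truncated
  subtraction and a test for zero as the only arithmetic.  Every symbol of an evaluated expression
  and every executed command costs at least one step.  Multiplication is deliberately not an
  instruction: without it, the bit length of all numbers grows at most linearly with the number
  of steps, so this uniform cost measure is polynomially equivalent to time on Turing machines.
\<close>

datatype expr =
    Const nat
  | Reg nat
  | Mem expr
  | Add expr expr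
  | Sub expr expr

datatype cmd =
    Skip
  | Set nat expr
  | Store expr expr
  | Seq cmd cmd
  | Cond expr cmd cmd
  | Loop expr cmd

record state =
  regs :: "nat \<Rightarrow> nat"
  mem :: "nat \<Rightarrow> nat"

primrec eval_expr :: "expr \<Rightarrow> state \<Rightarrow> nat" where
  "eval_expr (Const c) s = c"
| "eval_expr (Reg x) s = regs s x"
| "eval_expr (Mem a) s = mem s (eval_expr a s)"
| "eval_expr (Add a b) s = eval_expr a s + eval_expr b s"
| "eval_expr (Sub a b) s = eval_expr a s - eval_expr b s"

primrec expr_cost :: "expr \<Rightarrow> nat" where
  "expr_cost (Const c) = 1"
| "expr_cost (Reg x) = 1"
| "expr_cost (Mem a) = expr_cost a + 1"
| "expr_cost (Add a b) = expr_cost a + expr_cost b + 1"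
| "expr_cost (Sub a b) = expr_cost a + expr_cost b + 1"

text \<open>
  \<open>exec c s t s'\<close>: started in state \<open>s\<close>, the program \<open>c\<close> halts after \<open>t\<close> steps in
  state \<open>s'\<close>.  Guards count as true when they are nonzero.
\<close>

inductive exec :: "cmd \<Rightarrow> state \<Rightarrow> nat \<Rightarrow> state \<Rightarrow> bool" where
  exec_Skip: "exec Skip s 1 s"
| exec_Set: "exec (Set x a) s (expr_cost a + 1) (s\<lparr>regs := (regs s)(x := eval_expr a s)\<rparr>)"
| exec_Store: "exec (Store a b) s (expr_cost a + expr_cost b + 1)
     (s\<lparr>mem := (mem s)(eval_expr a s := eval_expr b s)\<rparr>)"
| exec_Seq: "exec c s t s' \<Longrightarrow> exec d s' t' s'' \<Longrightarrow> exec (Seq c d) s (t + t' + 1) s''"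
| exec_Cond_true: "eval_expr a s \<noteq> 0 \<Longrightarrow> exec c s t s' \<Longrightarrow>
     exec (Cond a c d) s (expr_cost a + t + 1) s'"
| exec_Cond_false: "eval_expr a s = 0 \<Longrightarrow> exec d s t s' \<Longrightarrow>
     exec (Cond a c d) s (expr_cost a + t + 1) s'"
| exec_Loop_false: "eval_expr a s = 0 \<Longrightarrow> exec (Loop a c) s (expr_cost a + 1) s"
| exec_Loop_true: "eval_expr a s \<noteq> 0 \<Longrightarrow> exec c s t s' \<Longrightarrow> exec (Loop a c) s' t' s'' \<Longrightarrow>
     exec (Loop a c) s (expr_cost a + t + t' + 1) s''"

lemma exec_deterministic:
  "exec c s t s' \<Longrightarrow> exec c s t' s'' \<Longrightarrow> t = t' \<and> s' = s''"
proof (induction arbitrary: t' s'' rule: exec.induct)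
  case exec_Skip
  then show ?case by (auto elim: exec.cases)
next
  case exec_Set
  then show ?case by (auto elim: exec.cases)
next
  case exec_Store
  then show ?case by (auto elim: exec.cases)
next
  case (exec_Seq c s t s' d t' s'')
  from exec_Seq.prems show ?case by cases (use exec_Seq.IH in blast)+
next
  case (exec_Cond_true a s c t s' d)
  from exec_Cond_true.prems show ?case
    by cases (use exec_Cond_true in blast)+
next
  case (exec_Cond_false a s d t s' c)
  from exec_Cond_false.prems show ?case
    by cases (use exec_Cond_false in blast)+
next
  case (exec_Loop_false a s c)
  from exec_Loop_false.prems show ?case
    by cases (use exec_Loop_false in auto)
next
  case (exec_Loop_true a s c t s' t' s'')
  from exec_Loop_true.prems show ?case
    by cases (use exec_Loop_true in blast)+
qed

text \<open>
  A word (a list of numbers) is passed with its length in register \<open>0\<close> and its entries in the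
  memory cells \<open>0, 1, \<dots>\<close>; the result is returned in the same way.
\<close>

definition initial_state :: "nat list \<Rightarrow> state" where
  "initial_state xs =
     \<lparr>regs = (\<lambda>_. 0)(0 := length xs),
      mem = (\<lambda>i. if i < length xs then xs ! i else 0)\<rparr>"

definition output_word :: "state \<Rightarrow> nat list" where
  "output_word s = map (mem s) [0..<regs s 0]"

definition poly_time_computable_on :: "nat list set \<Rightarrow> (nat list \<Rightarrow> nat list) \<Rightarrow> bool" where
  "poly_time_computable_on X f \<longleftrightarrow>
     (\<exists>c (p :: nat poly). \<forall>xs \<in> X. \<exists>t s.
        exec c (initial_state xs) t s \<and> t \<le> poly p (length xs) \<and> output_word s = f xs)"

text \<open>
  Encodings of instances on the vertex set \<open>{..<n}\<close> and of marked posets on \<open>{..<m}\<close>, by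
  the number of elements followed by characteristic bits.  The number \<open>n\<close> never exceeds the
  length of the encoding, so that length is a fair measure of the input size.
  The sets \<open>F i j\<close> (edges or non-edges) of the witness are not part of the input.
\<close>

definition relation_bits :: "nat \<Rightarrow> (nat \<Rightarrow> nat \<Rightarrow> bool) \<Rightarrow> nat list" where
  "relation_bits n R = concat (map (\<lambda>u. map (\<lambda>v. of_bool (R u v)) [0..<n]) [0..<n])"

definition set_bits :: "nat \<Rightarrow> nat set \<Rightarrow> nat list" where
  "set_bits n A = map (\<lambda>u. of_bool (u \<in> A)) [0..<n]"

definition encode_instance ::
  "nat \<Rightarrow> nat \<Rightarrow> nat set set \<Rightarrow> (nat \<Rightarrow> nat set) \<Rightarrow> (nat \<Rightarrow> nat \<Rightarrow> nat rel) \<Rightarrow> nat list" where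
  "encode_instance k n E P L =
     n # relation_bits n (\<lambda>u v. {u, v} \<in> E) @
     concat (map (\<lambda>i. set_bits n (P i)) [1..<Suc k]) @
     concat (map (\<lambda>i. concat (map (\<lambda>j. relation_bits n (\<lambda>u v. (u, v) \<in> L i j)) [i..<Suc k]))
       [1..<Suc k])"

definition encode_marked_poset ::
  "nat \<Rightarrow> nat \<Rightarrow> nat rel \<Rightarrow> (nat \<Rightarrow> nat set) \<Rightarrow> nat list" where
  "encode_marked_poset q m r M =
     m # relation_bits m (\<lambda>a b. (a, b) \<in> r) @ concat (map (\<lambda>i. set_bits m (M i)) [0..<q])"

definition mixed_thin_instances :: "nat \<Rightarrow> nat list set" where
  "mixed_thin_instances k =
     {encode_instance k n E P L | n E P L.
        simple_graph {..<n} E \<and> mixed_thin_witness k {..<n} E P L}"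

end

theory Submission
  imports Defs
begin

text \<open>
  In an inversion-free proper mixed-thin graph, the pairs of the set \<open>F i j\<close> (edges or non-edges)
  look like the pairs of intersecting intervals of a proper interval representation along the
  order of \<open>V\<^sub>i \<union> V\<^sub>j\<close>: conditions (b) and (c) say that non-membership in \<open>F i j\<close> is
  inherited by pairs that are further apart.  Hence restricting the order to the pairs in a common
  part and to the pairs outside \<open>F i j\<close> yields a partial order, a union of two chains in which
  comparability of elements of distinct parts encodes adjacency.  Since these orders cannot be put
  on the same elements for all \<open>i < j\<close> without creating unwanted comparabilities, each pair gets
  its own copy of the vertices; the copies all lie above the original vertices, so transitivity
  creates no relation between different copies.  The diagonal pairs \<open>i = j\<close> are encoded by one
  further copy of \<open>V\<close> that plays the role of right interval ends.

  For the algorithm, every bit of the output is given by a bounded first-order condition on the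
  input bits.  Such conditions are expressed in a small language of arithmetic terms with bounded
  sums, all of whose terms compile to polynomial-time programs.
\<close>

section \<open>A term language for polynomial time\<close>

text \<open>Inside a single part all vertices form a chain, so comparability of the vertices cannot
  tell neighbours from non-neighbours. This is why the diagonal needs right ends:
  \<open>(1, u)\<close> lies below \<open>(0, v)\<close> exactly when \<open>u\<close> comes
  strictly before \<open>v\<close> in their common part and the pair is outside the chosen set. A
  further obstacle is that a first-order formula sees only the order and finitely many marks, so it
  cannot follow the correspondence between a vertex and its copies. Adjacency is therefore phrased
  by order alone: by a right end lying between two vertices, or by comparing what lies above two
  vertices in a block. The choice between \<open>E\<close> and its complement is only known to exist
  and is not part of the input; it has to be recovered from \<open>E\<close> and handed to the
  formula by one mark per pair. Finally, every block carries all of \<open>V\<close>, which permits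
  the uniform numbering \<open>c * n + u\<close>; this costs a third chain per pair, and 3 stays
  below the 5 of the bound.\<close>

definition run :: "cmd \<Rightarrow> state \<Rightarrow> nat \<Rightarrow> (state \<Rightarrow> bool) \<Rightarrow> bool" where
  "run c s T Q \<longleftrightarrow> (\<exists>t s'. exec c s t s' \<and> t \<le> T \<and> Q s')"

lemma run_weaken:
  "run c s T Q \<Longrightarrow> T \<le> T' \<Longrightarrow> (\<And>s'. Q s' \<Longrightarrow> Q' s') \<Longrightarrow> run c s T' Q'"
  unfolding run_def by (meson le_trans)

lemma run_Set:
  "Q (s\<lparr>regs := (regs s)(x := eval_expr a s)\<rparr>) \<Longrightarrow> expr_cost a + 1 \<le> T \<Longrightarrow> run (Set x a) s T Q"
  unfolding run_def using exec_Set by blast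

lemma run_Store:
  "Q (s\<lparr>mem := (mem s)(eval_expr a s := eval_expr b s)\<rparr>) \<Longrightarrow> expr_cost a + expr_cost b + 1 \<le> T \<Longrightarrow>
     run (Store a b) s T Q"
  unfolding run_def using exec_Store by blast

text \<open>Costs are budgets, not exact counts: the first command gets \<open>T'\<close>, and what
  remains of \<open>T\<close> is handed to the rest, so a proof walks through a program from left to
  right.\<close>

lemma run_Seq:
  assumes "run c s T' (\<lambda>s'. run d s' (T - (T' + 1)) Q)" "T' + 1 \<le> T"
  shows "run (Seq c d) s T Q"
proof -
  obtain t s' t' s'' where "exec c s t s'" "t \<le> T'" "exec d s' t' s''" "t' \<le> T - (T' + 1)" "Q s''"
    using assms unfolding run_def by blast
  then have "exec (Seq c d) s (t + t' + 1) s''" "t + t' + 1 \<le> T"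
    using assms(2) exec_Seq[of c s t s' d t' s''] by auto
  then show ?thesis using \<open>Q s''\<close> unfolding run_def by blast
qed

lemma run_Set_Seq:
  "run d (s\<lparr>regs := (regs s)(x := eval_expr a s)\<rparr>) (T - (expr_cost a + 2)) Q \<Longrightarrow>
     expr_cost a + 2 \<le> T \<Longrightarrow> run (Seq (Set x a) d) s T Q"
  by (rule run_Seq, rule run_Set[OF _ le_refl]) auto

lemma run_Store_Seq:
  "run d (s\<lparr>mem := (mem s)(eval_expr a s := eval_expr b s)\<rparr>) (T - (expr_cost a + expr_cost b + 2)) Q \<Longrightarrow>
     expr_cost a + expr_cost b + 2 \<le> T \<Longrightarrow> run (Seq (Store a b) d) s T Q"
  by (rule run_Seq, rule run_Store[OF _ le_refl]) auto

lemma run_Cond: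
  assumes "eval_expr a s \<noteq> 0 \<Longrightarrow> run c s (T - (expr_cost a + 1)) Q"
    and "eval_expr a s = 0 \<Longrightarrow> run d s (T - (expr_cost a + 1)) Q"
    and "expr_cost a + 1 \<le> T"
  shows "run (Cond a c d) s T Q"
proof (cases "eval_expr a s = 0")
  case True
  with assms(2,3) obtain t s' where *: "exec d s t s'" "expr_cost a + t + 1 \<le> T" "Q s'"
    unfolding run_def by fastforce
  from exec_Cond_false[OF True *(1), of c] *(2,3) show ?thesis unfolding run_def by blast
next
  case False
  with assms(1,3) obtain t s' where *: "exec c s t s'" "expr_cost a + t + 1 \<le> T" "Q s'"
    unfolding run_def by fastforce
  from exec_Cond_true[OF False *(1), of d] *(2,3) show ?thesis unfolding run_def by blast
qed

text \<open>The number \<open>N\<close> of passes is fixed in advance and the invariant is indexed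
  by the passes already made, so the cost is a sum of one budget per pass.\<close>

lemma run_Loop:
  assumes init: "I 0 s"
    and step: "\<And>j s. j < N \<Longrightarrow> I j s \<Longrightarrow> eval_expr a s \<noteq> 0 \<and> run c s (Tb j) (I (Suc j))"
    and final: "\<And>s. I N s \<Longrightarrow> eval_expr a s = 0"
  shows "run (Loop a c) s ((\<Sum>j<N. Tb j + expr_cost a + 1) + expr_cost a + 1) (I N)"
proof -
  let ?g = "\<lambda>j. Tb j + expr_cost a + 1"
  \<comment> \<open>Induction on the number \<open>i\<close> of passes still ahead, because the rule
    for loops peels off the first pass.\<close>
  have "I (N - i) s \<Longrightarrow> i \<le> N \<Longrightarrow>
      run (Loop a c) s ((\<Sum>j\<in>{N - i..<N}. ?g j) + expr_cost a + 1) (I N)" for i s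
  proof (induction i arbitrary: s)
    case 0
    then show ?case using exec_Loop_false[OF final, of s c] unfolding run_def by auto
  next
    case (Suc i)
    let ?j = "N - Suc i"
    have j: "?j < N" "Suc ?j = N - i" using Suc.prems(2) by auto
    obtain t s' where c: "eval_expr a s \<noteq> 0" "exec c s t s'" "t \<le> Tb ?j" "I (N - i) s'"
      using step[OF j(1) Suc.prems(1)] unfolding run_def j(2) by blast
    obtain t' s'' where l: "exec (Loop a c) s' t' s''"
      "t' \<le> (\<Sum>j\<in>{N - i..<N}. ?g j) + expr_cost a + 1" "I N s''"
      using Suc.IH[OF c(4)] Suc.prems(2) unfolding run_def by auto
    have "(\<Sum>j\<in>{?j..<N}. ?g j) = ?g ?j + (\<Sum>j\<in>{N - i..<N}. ?g j)"
      using sum.atLeast_Suc_lessThan[OF j(1), of ?g] unfolding j(2) .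
    then have "expr_cost a + t + t' + 1 \<le> (\<Sum>j\<in>{?j..<N}. ?g j) + expr_cost a + 1"
      using c(3) l(2) by simp
    then show ?case using exec_Loop_true[OF c(1,2) l(1)] l(3) unfolding run_def by blast
  qed
  from this[of N s] init show ?thesis by (simp add: lessThan_atLeast0)
qed

section \<open>Arithmetic terms with bounded sums and their compilation\<close>

datatype tm =
    TC nat
  | TV nat
  | TIn tm
  | TAdd tm tm
  | TSub tm tm
  | TMul tm tm
  | TSum nat tm tm

text \<open>Positions beyond the input read as 0. The range of a sum is evaluated before its
  variable is bound, so the length of every loop is known when it starts.\<close>

primrec teval :: "tm \<Rightarrow> nat list \<Rightarrow> (nat \<Rightarrow> nat) \<Rightarrow> nat" where
  "teval (TC c) xs e = c"
| "teval (TV v) xs e = e v"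
| "teval (TIn t) xs e = (if teval t xs e < length xs then xs ! teval t xs e else 0)"
| "teval (TAdd s t) xs e = teval s xs e + teval t xs e"
| "teval (TSub s t) xs e = teval s xs e - teval t xs e"
| "teval (TMul s t) xs e = teval s xs e * teval t xs e"
| "teval (TSum x s t) xs e = (\<Sum>a<teval s xs e. teval t xs (e(x := a)))"

text \<open>An upper bound on the running time of the compiled code. The 11 and 14 are the overhead
  of one loop pass, guard included; the other constants have some slack.\<close>

primrec tcost :: "tm \<Rightarrow> nat list \<Rightarrow> (nat \<Rightarrow> nat) \<Rightarrow> nat" where
  "tcost (TC c) xs e = 2"
| "tcost (TV v) xs e = 2"
| "tcost (TIn t) xs e = tcost t xs e + 9"
| "tcost (TAdd s t) xs e = tcost s xs e + tcost t xs e + 6"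
| "tcost (TSub s t) xs e = tcost s xs e + tcost t xs e + 6"
| "tcost (TMul s t) xs e = tcost s xs e + tcost t xs e + teval s xs e * 11 + 20"
| "tcost (TSum x s t) xs e =
     tcost s xs e + (\<Sum>a<teval s xs e. tcost t xs (e(x := a)) + 14) + 20"

text \<open>Positive even registers hold variables and odd ones hold temporaries, which keeps both
  apart from register 0.\<close>

definition var :: "nat \<Rightarrow> nat" where
  "var v = 2 * v + 2"

definition tmp :: "nat \<Rightarrow> nat" where
  "tmp d = 2 * d + 1"

lemma var_tmp [simp]:
  "var v = var w \<longleftrightarrow> v = w" "tmp c = tmp d \<longleftrightarrow> c = d" "var v \<noteq> tmp d" "tmp d \<noteq> var v"
  "var v \<noteq> 0" "tmp d \<noteq> 0" "0 \<noteq> var v" "0 \<noteq> tmp d"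
  unfolding var_def tmp_def by presburger+

text \<open>Register \<open>0\<close> holds the input length throughout, so input lookups can be guarded by it.\<close>

primrec compile_term :: "tm \<Rightarrow> nat \<Rightarrow> cmd" where
  "compile_term (TC c) d = Set (tmp d) (Const c)"
| "compile_term (TV v) d = Set (tmp d) (Reg (var v))"
| "compile_term (TIn t) d = Seq (compile_term t d)
     (Cond (Sub (Reg 0) (Reg (tmp d))) (Set (tmp d) (Mem (Reg (tmp d)))) (Set (tmp d) (Const 0)))"
| "compile_term (TAdd s t) d = Seq (compile_term s d) (Seq (compile_term t (d+1))
     (Set (tmp d) (Add (Reg (tmp d)) (Reg (tmp (d+1))))))"
| "compile_term (TSub s t) d = Seq (compile_term s d) (Seq (compile_term t (d+1))
     (Set (tmp d) (Sub (Reg (tmp d)) (Reg (tmp (d+1))))))"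
| "compile_term (TMul s t) d = Seq (compile_term s d) (Seq (compile_term t (d+1)) (Seq (Set (tmp (d+2)) (Const 0))
     (Seq (Loop (Reg (tmp d)) (Seq (Set (tmp (d+2)) (Add (Reg (tmp (d+2))) (Reg (tmp (d+1)))))
                                   (Set (tmp d) (Sub (Reg (tmp d)) (Const 1)))))
          (Set (tmp d) (Reg (tmp (d+2)))))))"
| "compile_term (TSum x s t) d = Seq (compile_term s d) (Seq (Set (tmp (d+1)) (Reg (var x)))
     (Seq (Set (tmp (d+2)) (Const 0)) (Seq (Set (var x) (Const 0))
     (Seq (Loop (Sub (Reg (tmp d)) (Reg (var x)))
             (Seq (compile_term t (d+3)) (Seq (Set (tmp (d+2)) (Add (Reg (tmp (d+2))) (Reg (tmp (d+3)))))
                                      (Set (var x) (Add (Reg (var x)) (Const 1))))))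
     (Seq (Set (var x) (Reg (tmp (d+1)))) (Set (tmp d) (Reg (tmp (d+2)))))))))"

definition holds_input :: "nat list \<Rightarrow> state \<Rightarrow> bool" where
  "holds_input xs s \<longleftrightarrow> regs s 0 = length xs \<and> (\<forall>i<length xs. mem s i = xs ! i)"

definition vars :: "state \<Rightarrow> nat \<Rightarrow> nat" where
  "vars s v = regs s (var v)"

text \<open>Evaluation at depth \<open>d\<close> may overwrite any temporary from \<open>d\<close>
  upwards, so an enclosing evaluation keeps its intermediate results below \<open>d\<close>.\<close>

definition computed :: "nat \<Rightarrow> nat \<Rightarrow> state \<Rightarrow> state \<Rightarrow> bool" where
  "computed d y s s' \<longleftrightarrow> mem s' = mem s \<and> regs s' 0 = regs s 0 \<and>
     (\<forall>v. regs s' (var v) = regs s (var v)) \<and> (\<forall>e<d. regs s' (tmp e) = regs s (tmp e)) \<and>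
     regs s' (tmp d) = y"

lemma computed_holds_input: "computed d y s s' \<Longrightarrow> holds_input xs s \<Longrightarrow> holds_input xs s'"
  by (simp add: computed_def holds_input_def)

lemma computed_vars: "computed d y s s' \<Longrightarrow> vars s' = vars s"
  by (simp add: computed_def vars_def fun_eq_iff)

lemma vars_update: "vars (s\<lparr>regs := f\<rparr>) = (\<lambda>v. f (var v))"
  by (simp add: vars_def fun_eq_iff)

lemma run_compile_term:
  "holds_input xs s \<Longrightarrow>
     run (compile_term t d) s (tcost t xs (vars s)) (computed d (teval t xs (vars s)) s)"
proof (induction t arbitrary: d s)
  case (TC c)
  show ?case by (simp, rule run_Set) (auto simp: computed_def)
next
  case (TV v)
  show ?case by (simp, rule run_Set) (auto simp: computed_def vars_def)
next
  case (TIn t)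
  show ?case unfolding compile_term.simps
  proof (rule run_Seq, rule run_weaken[OF TIn.IH[OF TIn.prems] le_refl], goal_cases)
    case (1 s')
    have "holds_input xs s'" using 1 TIn.prems by (rule computed_holds_input)
    then show ?case
      using 1 by (intro run_Cond run_Set) (auto simp: computed_def holds_input_def)
  qed auto
next
  case (TAdd t1 t2)
  have IH2: "run (compile_term t2 (d+1)) s' (tcost t2 xs (vars s)) (computed (d+1) (teval t2 xs (vars s)) s')"
    if "computed d (teval t1 xs (vars s)) s s'" for s'
    using TAdd.IH(2)[OF computed_holds_input[OF that TAdd.prems], of "d+1"]
    unfolding computed_vars[OF that] .
  show ?case unfolding compile_term.simps
  proof (rule run_Seq, rule run_weaken[OF TAdd.IH(1)[OF TAdd.prems] le_refl],
      rule run_Seq, rule run_weaken[OF IH2 le_refl], assumption, goal_cases)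
    case (1 s' s'')
    then show ?case by (intro run_Set) (auto simp: computed_def)
  qed auto
next
  case (TSub t1 t2)
  have IH2: "run (compile_term t2 (d+1)) s' (tcost t2 xs (vars s)) (computed (d+1) (teval t2 xs (vars s)) s')"
    if "computed d (teval t1 xs (vars s)) s s'" for s'
    using TSub.IH(2)[OF computed_holds_input[OF that TSub.prems], of "d+1"]
    unfolding computed_vars[OF that] .
  show ?case unfolding compile_term.simps
  proof (rule run_Seq, rule run_weaken[OF TSub.IH(1)[OF TSub.prems] le_refl],
      rule run_Seq, rule run_weaken[OF IH2 le_refl], assumption, goal_cases)
    case (1 s' s'')
    then show ?case by (intro run_Set) (auto simp: computed_def)
  qed auto
next
  case (TMul t1 t2)
  let ?m = "teval t1 xs (vars s)" and ?n = "teval t2 xs (vars s)"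
  have IH2: "run (compile_term t2 (d+1)) s' (tcost t2 xs (vars s)) (computed (d+1) ?n s')"
    if "computed d ?m s s'" for s'
    using TMul.IH(2)[OF computed_holds_input[OF that TMul.prems], of "d+1"]
    unfolding computed_vars[OF that] .
  define I where "I j s' \<longleftrightarrow> computed d (?m - j) s s' \<and> regs s' (tmp (d+1)) = ?n \<and>
    regs s' (tmp (d+2)) = j * ?n" for j and s' :: state
  have loop: "run (Loop (Reg (tmp d)) (Seq (Set (tmp (d+2)) (Add (Reg (tmp (d+2))) (Reg (tmp (d+1)))))
      (Set (tmp d) (Sub (Reg (tmp d)) (Const 1))))) s' (?m * 11 + 2) (I ?m)" if "I 0 s'" for s'
  proof (rule run_weaken, rule run_Loop[where Tb = "\<lambda>_. 9" and N = ?m and I = I], fact, goal_cases)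
    case (1 j s')
    then show ?case by (intro conjI run_Set_Seq run_Set) (auto simp: I_def computed_def)
  qed (auto simp: I_def computed_def)
  show ?case unfolding compile_term.simps
  proof (rule run_Seq, rule run_weaken[OF TMul.IH(1)[OF TMul.prems] le_refl],
      rule run_Seq, rule run_weaken[OF IH2 le_refl], assumption,
      rule run_Set_Seq, rule run_Seq, rule run_weaken[OF loop le_refl], goal_cases)
    case (1 s' s'')
    then show ?case by (simp add: I_def computed_def)
  next
    case (2 s' s'' s3)
    then show ?case by (intro run_Set) (auto simp: I_def computed_def)
  qed auto
next
  case (TSum x t1 t2)
  let ?e = "vars s"
  let ?m = "teval t1 xs ?e"
  \<comment> \<open>During the loop the register of \<open>x\<close> holds the counter
    \<open>j\<close>. Its outer value waits in \<open>tmp (d+1)\<close> and is restored afterwards,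
    so a sum may rebind a variable that is in use.\<close>
  define I where "I j s' \<longleftrightarrow> mem s' = mem s \<and> regs s' 0 = regs s 0 \<and> vars s' = ?e(x := j) \<and>
    (\<forall>c<d. regs s' (tmp c) = regs s (tmp c)) \<and> regs s' (tmp d) = ?m \<and>
    regs s' (tmp (d+1)) = ?e x \<and> regs s' (tmp (d+2)) = (\<Sum>a<j. teval t2 xs (?e(x := a)))"
    for j and s' :: state
  have x_I: "regs s' (var x) = j" if "I j s'" for j s'
    using that by (simp add: I_def vars_def fun_eq_iff)
  let ?body = "Seq (compile_term t2 (d+3)) (Seq (Set (tmp (d+2)) (Add (Reg (tmp (d+2))) (Reg (tmp (d+3)))))
     (Set (var x) (Add (Reg (var x)) (Const 1))))"
  let ?T = "(\<Sum>j<?m. tcost t2 xs (?e(x := j)) + 14) + 4"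
  have loop: "run (Loop (Sub (Reg (tmp d)) (Reg (var x))) ?body) s' ?T (I ?m)" if "I 0 s'" for s'
  proof (rule run_weaken, rule run_Loop[where Tb = "\<lambda>j. tcost t2 xs (?e(x := j)) + 10" and
        N = ?m and I = I], fact, goal_cases)
    case (1 j s')
    have inp: "holds_input xs s'" using TSum.prems 1 by (auto simp: holds_input_def I_def)
    have v: "vars s' = ?e(x := j)" using 1 by (simp add: I_def)
    have IH2: "run (compile_term t2 (d+3)) s' (tcost t2 xs (?e(x := j))) (computed (d+3) (teval t2 xs (?e(x := j))) s')"
      using TSum.IH(2)[OF inp, of "d+3"] unfolding v .
    have "run ?body s' (tcost t2 xs (?e(x := j)) + 10) (I (Suc j))"
    proof (rule run_Seq, rule run_weaken[OF IH2 le_refl], goal_cases)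
      case (1 s'')
      then show ?case using \<open>I j s'\<close> x_I[OF \<open>I j s'\<close>]
        by (intro run_Set_Seq run_Set) (auto simp: I_def computed_def vars_def fun_eq_iff)
    qed auto
    then show ?case using 1 x_I[OF 1(2)] by (simp add: I_def)
  qed (auto simp: x_I add.commute, simp add: I_def)
  show ?case unfolding compile_term.simps
  proof (rule run_Seq, rule run_weaken[OF TSum.IH(1)[OF TSum.prems] le_refl],
      rule run_Set_Seq, rule run_Set_Seq, rule run_Set_Seq, rule run_Seq,
      rule run_weaken[OF loop le_refl], goal_cases)
    case (1 s')
    then show ?case by (auto simp: I_def computed_def vars_update vars_def[symmetric] fun_eq_iff)
  next
    case (2 s' s'')
    then show ?case by (intro run_Set_Seq run_Set) (auto simp: I_def computed_def vars_update vars_def[symmetric] fun_eq_iff)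
  qed auto
qed

section \<open>Polynomial bounds on values and costs\<close>

lemma mult_powers_le: "64 * ((B + 2) ^ c * (B + 2) ^ d) \<le> (B + 2 :: nat) ^ (c + d + 6)"
proof -
  have "(2::nat) ^ 6 \<le> (B + 2) ^ 6" by (rule power_mono) auto
  then show ?thesis by (simp add: power_add)
qed

text \<open>The base \<open>B + 2\<close> is at least 2, so constant factors and summands are
  absorbed by raising the exponent. The exponent depends on the term only and \<open>B\<close> stays
  universally quantified, which lets the induction hypothesis be applied with a larger bound under a
  sum.\<close>

lemma teval_tcost_bound:
  "\<exists>c. \<forall>xs e B. (\<forall>v. e v \<le> B) \<longrightarrow> (\<forall>y \<in> set xs. y \<le> B) \<longrightarrow>
     teval t xs e \<le> (B + 2) ^ c \<and> tcost t xs e \<le> (B + 2) ^ c"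
proof (induction t)
  case (TC k)
  have "k \<le> (B + 2) ^ (k + 1)" "2 \<le> (B + 2) ^ (k + 1)" for B :: nat
  proof -
    have "k < 2 ^ k" by (rule less_exp)
    also have "(2::nat) ^ k \<le> (B + 2) ^ k" by (rule power_mono) auto
    also have "\<dots> \<le> (B + 2) ^ (k + 1)" by (rule power_increasing) auto
    finally show "k \<le> (B + 2) ^ (k + 1)" by simp
    have "(B + 2) ^ 1 \<le> (B + 2) ^ (k + 1)" by (rule power_increasing) auto
    then show "2 \<le> (B + 2) ^ (k + 1)" by simp
  qed
  then show ?case by (intro exI[of _ "k + 1"]) simp
next
  case (TV v)
  show ?case by (intro exI[of _ 1]) (auto intro: le_SucI)
next
  case (TIn t)
  then obtain c where c: "\<And>xs e B. (\<forall>v. e v \<le> B) \<Longrightarrow> (\<forall>y \<in> set xs. y \<le> B) \<Longrightarrow>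
     teval t xs e \<le> (B + 2) ^ c \<and> tcost t xs e \<le> (B + 2) ^ c" by blast
  show ?case
  proof (intro exI[of _ "c + 4"] allI impI)
    fix xs :: "nat list" and e :: "nat \<Rightarrow> nat" and B :: nat
    assume *: "\<forall>v. e v \<le> B" "\<forall>y \<in> set xs. y \<le> B"
    let ?p = "(B + 2) ^ c"
    have p: "1 \<le> ?p" by simp
    have "(2::nat) ^ 4 \<le> (B + 2) ^ 4" by (rule power_mono) auto
    then have q: "16 * ?p \<le> (B + 2) ^ (c + 4)" by (simp add: power_add)
    have "(B + 2) ^ 1 \<le> (B + 2) ^ (c + 4)" by (rule power_increasing) auto
    then have "teval (TIn t) xs e \<le> (B + 2) ^ (c + 4)"
      using *(2) nth_mem[of "teval t xs e" xs] by (fastforce intro: order_trans[of _ B])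
    moreover have "tcost (TIn t) xs e \<le> (B + 2) ^ (c + 4)"
      using c[OF *, THEN conjunct2] p q unfolding tcost.simps by linarith
    ultimately show "teval (TIn t) xs e \<le> (B + 2) ^ (c + 4) \<and> tcost (TIn t) xs e \<le> (B + 2) ^ (c + 4)" ..
  qed
next
  case (TAdd s t)
  then obtain c d where c: "\<And>xs e B. (\<forall>v. e v \<le> B) \<Longrightarrow> (\<forall>y \<in> set xs. y \<le> B) \<Longrightarrow>
     teval s xs e \<le> (B + 2) ^ c \<and> tcost s xs e \<le> (B + 2) ^ c"
    and d: "\<And>xs e B. (\<forall>v. e v \<le> B) \<Longrightarrow> (\<forall>y \<in> set xs. y \<le> B) \<Longrightarrow>
     teval t xs e \<le> (B + 2) ^ d \<and> tcost t xs e \<le> (B + 2) ^ d" by blast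
  show ?case
  proof (intro exI[of _ "c + d + 3"] allI impI)
    fix xs :: "nat list" and e :: "nat \<Rightarrow> nat" and B :: nat
    assume *: "\<forall>v. e v \<le> B" "\<forall>y \<in> set xs. y \<le> B"
    let ?p = "(B + 2) ^ c" and ?q = "(B + 2) ^ d"
    have p: "1 \<le> ?p * ?q" "?p \<le> ?p * ?q" "?q \<le> ?p * ?q" by auto
    have "(2::nat) ^ 3 \<le> (B + 2) ^ 3" by (rule power_mono) auto
    then have "8 * (?p * ?q) \<le> (B + 2) ^ (c + d + 3)" by (simp add: power_add)
    then show "teval (TAdd s t) xs e \<le> (B + 2) ^ (c + d + 3) \<and> tcost (TAdd s t) xs e \<le> (B + 2) ^ (c + d + 3)"
      using c[OF *, THEN conjunct1] c[OF *, THEN conjunct2] d[OF *, THEN conjunct1] d[OF *, THEN conjunct2] p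
      unfolding teval.simps tcost.simps by (intro conjI; linarith)
  qed
next
  case (TSub s t)
  then obtain c d where c: "\<And>xs e B. (\<forall>v. e v \<le> B) \<Longrightarrow> (\<forall>y \<in> set xs. y \<le> B) \<Longrightarrow>
     teval s xs e \<le> (B + 2) ^ c \<and> tcost s xs e \<le> (B + 2) ^ c"
    and d: "\<And>xs e B. (\<forall>v. e v \<le> B) \<Longrightarrow> (\<forall>y \<in> set xs. y \<le> B) \<Longrightarrow>
     teval t xs e \<le> (B + 2) ^ d \<and> tcost t xs e \<le> (B + 2) ^ d" by blast
  show ?case
  proof (intro exI[of _ "c + d + 3"] allI impI)
    fix xs :: "nat list" and e :: "nat \<Rightarrow> nat" and B :: nat
    assume *: "\<forall>v. e v \<le> B" "\<forall>y \<in> set xs. y \<le> B"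
    let ?p = "(B + 2) ^ c" and ?q = "(B + 2) ^ d"
    have p: "1 \<le> ?p * ?q" "?p \<le> ?p * ?q" "?q \<le> ?p * ?q" by auto
    have "(2::nat) ^ 3 \<le> (B + 2) ^ 3" by (rule power_mono) auto
    then have "8 * (?p * ?q) \<le> (B + 2) ^ (c + d + 3)" by (simp add: power_add)
    then show "teval (TSub s t) xs e \<le> (B + 2) ^ (c + d + 3) \<and> tcost (TSub s t) xs e \<le> (B + 2) ^ (c + d + 3)"
      using c[OF *, THEN conjunct1] c[OF *, THEN conjunct2] d[OF *, THEN conjunct1] d[OF *, THEN conjunct2] p
      unfolding teval.simps tcost.simps by (intro conjI; linarith)
  qed
next
  case (TMul s t)
  then obtain c d where c: "\<And>xs e B. (\<forall>v. e v \<le> B) \<Longrightarrow> (\<forall>y \<in> set xs. y \<le> B) \<Longrightarrow>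
     teval s xs e \<le> (B + 2) ^ c \<and> tcost s xs e \<le> (B + 2) ^ c"
    and d: "\<And>xs e B. (\<forall>v. e v \<le> B) \<Longrightarrow> (\<forall>y \<in> set xs. y \<le> B) \<Longrightarrow>
     teval t xs e \<le> (B + 2) ^ d \<and> tcost t xs e \<le> (B + 2) ^ d" by blast
  show ?case
  proof (intro exI[of _ "c + d + 6"] allI impI)
    fix xs :: "nat list" and e :: "nat \<Rightarrow> nat" and B :: nat
    assume *: "\<forall>v. e v \<le> B" "\<forall>y \<in> set xs. y \<le> B"
    let ?p = "(B + 2) ^ c" and ?q = "(B + 2) ^ d"
    have p: "1 \<le> ?p * ?q" "?p \<le> ?p * ?q" "?q \<le> ?p * ?q" by auto
    have "64 * (?p * ?q) \<le> (B + 2) ^ (c + d + 6)" by (rule mult_powers_le)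
    moreover have "teval s xs e * teval t xs e \<le> ?p * ?q"
      using c[OF *] d[OF *] by (intro mult_le_mono) auto
    ultimately show "teval (TMul s t) xs e \<le> (B + 2) ^ (c + d + 6) \<and> tcost (TMul s t) xs e \<le> (B + 2) ^ (c + d + 6)"
      using c[OF *, THEN conjunct1] c[OF *, THEN conjunct2] d[OF *, THEN conjunct1] d[OF *, THEN conjunct2] p
      unfolding teval.simps tcost.simps by (intro conjI; linarith)
  qed
next
  case (TSum x s t)
  then obtain c d where c: "\<And>xs e B. (\<forall>v. e v \<le> B) \<Longrightarrow> (\<forall>y \<in> set xs. y \<le> B) \<Longrightarrow>
     teval s xs e \<le> (B + 2) ^ c \<and> tcost s xs e \<le> (B + 2) ^ c"
    and d: "\<And>xs e B. (\<forall>v. e v \<le> B) \<Longrightarrow> (\<forall>y \<in> set xs. y \<le> B) \<Longrightarrow>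
     teval t xs e \<le> (B + 2) ^ d \<and> tcost t xs e \<le> (B + 2) ^ d" by blast
  let ?c = "c + (c + 2) * d + 6"
  show ?case
  proof (intro exI[of _ ?c] allI impI)
    fix xs :: "nat list" and e :: "nat \<Rightarrow> nat" and B :: nat
    assume *: "\<forall>v. e v \<le> B" "\<forall>y \<in> set xs. y \<le> B"
    let ?p = "(B + 2) ^ c" and ?q = "(B + 2) ^ ((c + 2) * d)" and ?N = "teval s xs e"
    have N: "?N \<le> ?p" using c[OF *] by simp
    \<comment> \<open>The summation variable may reach \<open>?p\<close>, so the body is bounded
      with \<open>B + ?p\<close> in place of \<open>B\<close>. Since
      \<open>B + ?p + 2 \<le> (B + 2) ^ (c + 2)\<close>, the exponent becomes
      \<open>(c + 2) * d\<close>.\<close>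
    have t: "teval t xs (e(x := a)) \<le> ?q \<and> tcost t xs (e(x := a)) \<le> ?q" if "a < ?N" for a
    proof -
      define X where "X = (B + 2) * ?p"
      have "(B + 2) * 1 \<le> X" unfolding X_def by (rule mult_le_mono2) simp
      moreover have "?p \<le> X" by (simp add: X_def)
      ultimately have "(B + 2) * 1 + ?p \<le> X + X" by (rule add_mono)
      then have "B + ?p + 2 \<le> 2 * X" by simp
      also have "\<dots> \<le> (B + 2) * X" by (rule mult_le_mono1) simp
      also have "\<dots> = (B + 2) ^ (c + 2)" by (simp add: X_def power_add power2_eq_square algebra_simps)
      finally have "(B + ?p + 2) ^ d \<le> ?q" unfolding power_mult by (rule power_mono) simp
      moreover have "\<forall>v. (e(x := a)) v \<le> B + ?p" using *(1) that N by (auto simp: trans_le_add1)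
      moreover have "\<forall>y \<in> set xs. y \<le> B + ?p" using *(2) by (auto simp: trans_le_add1)
      ultimately show ?thesis using d[of "e(x := a)" "B + ?p" xs] by (meson le_trans)
    qed
    have p: "1 \<le> ?p * ?q" "?p \<le> ?p * ?q" "?q \<le> ?p * ?q" by auto
    have pq: "64 * (?p * ?q) \<le> (B + 2) ^ ?c" by (rule mult_powers_le)
    have "teval (TSum x s t) xs e \<le> (\<Sum>a<?N. ?q)"
      unfolding teval.simps by (rule sum_mono) (use t in blast)
    also have "\<dots> = ?N * ?q" by simp
    also have "\<dots> \<le> ?p * ?q" using N by (rule mult_le_mono1)
    finally have v: "teval (TSum x s t) xs e \<le> ?p * ?q" .
    have "(\<Sum>a<?N. tcost t xs (e(x := a)) + 14) \<le> (\<Sum>a<?N. ?q + 14)"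
      by (rule sum_mono) (use t in \<open>blast intro: add_le_mono1\<close>)
    also have "\<dots> = ?N * (?q + 14)" by simp
    also have "\<dots> \<le> ?p * (?q + 14)" using N by (rule mult_le_mono1)
    also have "\<dots> = ?p * ?q + 14 * ?p" by algebra
    finally have "tcost (TSum x s t) xs e \<le> ?p + ?p * ?q + 14 * ?p + 20" using c[OF *] by simp
    with v pq p show "teval (TSum x s t) xs e \<le> (B + 2) ^ ?c \<and> tcost (TSum x s t) xs e \<le> (B + 2) ^ ?c"
      by (intro conjI; linarith)
  qed
qed

section \<open>Programs that compute a word entry by entry\<close>

definition tabulate :: "tm \<Rightarrow> tm \<Rightarrow> nat list \<Rightarrow> nat list" where
  "tabulate l t xs = map (\<lambda>i. teval t xs ((\<lambda>_. 0)(0 := i))) [0..<teval l xs (\<lambda>_. 0)]"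

text \<open>The output is first written behind the input, which is still being read, and then moved.\<close>

definition tabulate_cmd :: "tm \<Rightarrow> tm \<Rightarrow> cmd" where
  "tabulate_cmd l t = Seq (compile_term l 0)
     (Seq (Loop (Sub (Reg (tmp 0)) (Reg (var 0))) (Seq (compile_term t 1)
        (Seq (Store (Add (Reg 0) (Reg (var 0))) (Reg (tmp 1)))
             (Set (var 0) (Add (Reg (var 0)) (Const 1))))))
     (Seq (Set (var 0) (Const 0))
     (Seq (Loop (Sub (Reg (tmp 0)) (Reg (var 0)))
        (Seq (Store (Reg (var 0)) (Mem (Add (Reg 0) (Reg (var 0)))))
             (Set (var 0) (Add (Reg (var 0)) (Const 1)))))
     (Set 0 (Reg (tmp 0))))))"

text \<open>Evaluating \<open>TSum 0 l t\<close> computes the length and then every entry, just like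
  the first loop. Expressing the cost through this term makes the general bound on
  \<open>tcost\<close> applicable; moving the result is linear and is covered by the factor
  4.\<close>

lemma run_tabulate_cmd:
  "run (tabulate_cmd l t) (initial_state xs) (4 * tcost (TSum 0 l t) xs (\<lambda>_. 0) + 100)
     (\<lambda>s. output_word s = tabulate l t xs)"
proof -
  let ?e = "\<lambda>_::nat. 0::nat" and ?s = "initial_state xs" and ?n = "length xs"
  let ?L = "teval l xs ?e"
  let ?y = "\<lambda>i. teval t xs (?e(0 := i))"
  let ?C = "\<Sum>i<?L. tcost t xs (?e(0 := i)) + 14"
  have inp: "holds_input xs ?s" and v: "vars ?s = ?e"
    by (auto simp: holds_input_def vars_def initial_state_def)
  have l: "run (compile_term l 0) ?s (tcost l xs ?e) (computed 0 ?L ?s)"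
    using run_compile_term[OF inp, of l 0] unfolding v .
  have LC: "?L * 14 \<le> ?C" using sum_mono[of "{..<?L}" "\<lambda>_. 14" "\<lambda>i. tcost t xs (?e(0 := i)) + 14"] by simp
  define I where "I j s \<longleftrightarrow> holds_input xs s \<and> vars s = ?e(0 := j) \<and> regs s (tmp 0) = ?L \<and>
    (\<forall>i<j. mem s (?n + i) = ?y i)" for j and s :: state
  have var0: "regs s (var 0) = j" if "vars s = ?e(0 := j)" for s j
    using that unfolding vars_def fun_eq_iff by (metis fun_upd_same)
  have loop1: "run (Loop (Sub (Reg (tmp 0)) (Reg (var 0))) (Seq (compile_term t 1)
        (Seq (Store (Add (Reg 0) (Reg (var 0))) (Reg (tmp 1)))
             (Set (var 0) (Add (Reg (var 0)) (Const 1)))))) s (2 * ?C + 10) (I ?L)" if "I 0 s" for s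
  proof (rule run_weaken, rule run_Loop[where Tb = "\<lambda>j. tcost t xs (?e(0 := j)) + 11" and N = ?L and I = I],
      fact, goal_cases)
    case (1 j s)
    then have inp: "holds_input xs s" and v: "vars s = ?e(0 := j)" by (simp_all add: I_def)
    have IH: "run (compile_term t 1) s (tcost t xs (?e(0 := j))) (computed 1 (?y j) s)"
      using run_compile_term[OF inp, of t 1] unfolding v .
    have "run (Seq (compile_term t 1) (Seq (Store (Add (Reg 0) (Reg (var 0))) (Reg (tmp 1)))
             (Set (var 0) (Add (Reg (var 0)) (Const 1))))) s (tcost t xs (?e(0 := j)) + 11) (I (Suc j))"
    proof (rule run_Seq, rule run_weaken[OF IH le_refl], goal_cases)
      case (1 s')
      then show ?case using \<open>I j s\<close> var0[OF v]
        by (intro run_Store_Seq run_Set)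
          (auto simp: I_def computed_def holds_input_def vars_def fun_eq_iff less_Suc_eq)
    qed auto
    then show ?case using 1 var0[OF v] by (simp add: I_def)
  next
    case 3
    have "(\<Sum>j<?L. tcost t xs (?e(0 := j)) + 11 + expr_cost (Sub (Reg (tmp 0)) (Reg (var 0))) + 1)
        = ?C + ?L"
      unfolding sum.distrib by simp
    then show ?case using LC by simp
  qed (auto simp: I_def var0)
  \<comment> \<open>Moving upwards is safe: when cell \<open>j\<close> is overwritten, the entries
    still to be moved afterwards have indices \<open>i > j\<close> and lie in cells
    \<open>?n + i\<close>, beyond \<open>j\<close>.\<close>
  define J where "J j s \<longleftrightarrow> regs s 0 = ?n \<and> regs s (var 0) = j \<and> regs s (tmp 0) = ?L \<and>
    (\<forall>i<j. mem s i = ?y i) \<and> (\<forall>i. j \<le> i \<and> i < ?L \<longrightarrow> mem s (?n + i) = ?y i)" for j and s :: state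
  have loop2: "run (Loop (Sub (Reg (tmp 0)) (Reg (var 0)))
        (Seq (Store (Reg (var 0)) (Mem (Add (Reg 0) (Reg (var 0)))))
             (Set (var 0) (Add (Reg (var 0)) (Const 1))))) s (?L * 15 + 4) (J ?L)" if "J 0 s" for s
  proof (rule run_weaken, rule run_Loop[where Tb = "\<lambda>j. 11" and N = ?L and I = J], fact, goal_cases)
    case (1 j s)
    then show ?case
      by (intro conjI run_Store_Seq run_Set) (auto simp: J_def less_Suc_eq)
  qed (auto simp: J_def)
  have "run (tabulate_cmd l t) ?s (tcost l xs ?e + 2 * ?C + ?L * 15 + 25)
      (\<lambda>s. output_word s = tabulate l t xs)"
    unfolding tabulate_cmd_def
  proof (rule run_Seq, rule run_weaken[OF l le_refl], rule run_Seq, rule run_weaken[OF loop1 le_refl],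
      goal_cases)
    case (1 s)
    then show ?case using inp by (auto simp: I_def computed_def holds_input_def vars_def fun_eq_iff initial_state_def)
  next
    case (2 s s')
    show ?case
    proof (rule run_Set_Seq, rule run_Seq, rule run_weaken[OF loop2 le_refl], goal_cases)
      case 1
      then show ?case using 2(2) by (auto simp: I_def J_def holds_input_def)
    next
      case (2 s'')
      then show ?case
        by (intro run_Set[where Q = "\<lambda>s. output_word s = tabulate l t xs"])
          (auto simp: J_def output_word_def tabulate_def)
    qed auto
  qed auto
  then show ?thesis by (rule run_weaken) (use LC in auto)
qed

text \<open>With entries bounded by the length of the word, that length serves as \<open>B\<close>,
  and \<open>(length xs + 2) ^ c\<close> is a polynomial in it.\<close>

theorem poly_time_tabulate:
  assumes "\<And>xs y. xs \<in> X \<Longrightarrow> y \<in> set xs \<Longrightarrow> y \<le> length xs"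
  shows "poly_time_computable_on X (tabulate l t)"
proof -
  obtain c where c: "\<And>xs e B. (\<forall>v. e v \<le> B) \<Longrightarrow> (\<forall>y \<in> set xs. y \<le> B) \<Longrightarrow>
      tcost (TSum 0 l t) xs e \<le> (B + 2) ^ c"
    using teval_tcost_bound[of "TSum 0 l t"] by blast
  let ?p = "4 * [:2, 1:] ^ c + [:100:] :: nat poly"
  have "\<exists>u s. exec (tabulate_cmd l t) (initial_state xs) u s \<and> u \<le> poly ?p (length xs) \<and>
      output_word s = tabulate l t xs" if "xs \<in> X" for xs
  proof -
    have "tcost (TSum 0 l t) xs (\<lambda>_. 0) \<le> (length xs + 2) ^ c"
      using assms[OF that] by (intro c) auto
    moreover have "poly ?p (length xs) = 4 * (length xs + 2) ^ c + 100"
      by (simp add: add.commute)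
    ultimately show ?thesis
      using run_tabulate_cmd[of l t xs] unfolding run_def by fastforce
  qed
  then show ?thesis unfolding poly_time_computable_on_def by blast
qed

section \<open>Isomorphic images\<close>

definition map_structure :: "('a \<Rightarrow> 'b) \<Rightarrow> ('r, 'a) rel_structure \<Rightarrow> ('r, 'b) rel_structure" where
  "map_structure h \<AA> = \<lparr>universe = h ` universe \<AA>, interp = (\<lambda>r. map h ` interp \<AA> r)\<rparr>"

lemma map_mem_image_iff:
  assumes "inj_on h D" "set xs \<subseteq> D" "\<And>ys. ys \<in> X \<Longrightarrow> set ys \<subseteq> D"
  shows "map h xs \<in> map h ` X \<longleftrightarrow> xs \<in> X"
proof
  assume "map h xs \<in> map h ` X"
  then obtain ys where ys: "ys \<in> X" "map h xs = map h ys" by auto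
  then have "set xs \<union> set ys \<subseteq> D" using assms by auto
  then have "xs = ys" using ys(2) assms(1) by (meson inj_on_subset map_inj_on)
  with ys show "xs \<in> X" by simp
qed auto

text \<open>Only free variables are required to take values in the universe, because tuples are
  passed as \<open>\<lambda>i. xs ! i\<close>, which is unspecified beyond their length.\<close>

lemma sat_image:
  assumes h: "inj_on h (universe \<AA>)" and U: "universe \<BB> = h ` universe \<AA>"
    and I: "\<And>r xs. set xs \<subseteq> universe \<AA> \<Longrightarrow> map h xs \<in> interp \<BB> r \<longleftrightarrow> xs \<in> interp \<AA> r"
  shows "\<forall>x \<in> free_vars \<phi>. e x \<in> universe \<AA> \<and> e' x = h (e x) \<Longrightarrow> sat \<BB> e' \<phi> \<longleftrightarrow> sat \<AA> e \<phi>"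
proof (induction \<phi> arbitrary: e e')
  case (Eq x y)
  then show ?case using h by (auto simp: inj_on_def)
next
  case (Rel r xs)
  then have "map e' xs = map h (map e xs)" "set (map e xs) \<subseteq> universe \<AA>" by auto
  then show ?case using I[of "map e xs" r] unfolding sat.simps by metis
next
  case (Exi x \<phi>)
  have "sat \<BB> (e'(x := h a)) \<phi> \<longleftrightarrow> sat \<AA> (e(x := a)) \<phi>" if "a \<in> universe \<AA>" for a
    using Exi that by (intro Exi.IH) auto
  then show ?case by (simp add: U)
next
  case (Neg \<phi>)
  then show ?case by auto
next
  case (Conj \<phi> \<psi>)
  have "sat \<BB> e' \<phi> \<longleftrightarrow> sat \<AA> e \<phi>" "sat \<BB> e' \<psi> \<longleftrightarrow> sat \<AA> e \<psi>"
    using Conj by auto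
  then show ?case by simp
qed

text \<open>Transductions commute with isomorphisms. This permits building the poset on pairs of a
  block number and a vertex and renaming its elements only at the end.\<close>

lemma transduce_marked_image:
  assumes T: "is_transduction \<Sigma> \<Gamma> T" and \<AA>: "structure_over \<Sigma> \<AA>" and M: "is_marking T \<AA> M"
    and h: "inj_on h (universe \<AA>)"
  shows "transduce_marked \<Gamma> T (map_structure h \<AA>) (\<lambda>i. h ` M i) = map_structure h (transduce_marked \<Gamma> T \<AA> M)"
proof -
  let ?q = "num_marks T"
  let ?A = "mark_structure ?q M \<AA>" and ?B = "mark_structure ?q (\<lambda>i. h ` M i) (map_structure h \<AA>)"
  let ?I = "scheme T"
  have UA: "universe ?A = universe \<AA>" and UB: "universe ?B = h ` universe ?A"
    by (simp_all add: mark_structure_def map_structure_def)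
  have over: "set ys \<subseteq> universe \<AA>" if "ys \<in> interp ?A r" for ys r
    using structure_over_mark_structure[OF \<AA> M] that unfolding structure_over_def UA by blast
  have interp: "interp ?B r = map h ` interp ?A r" for r
    by (auto simp: mark_structure_def map_structure_def Setcompr_eq_image image_image split: sum.splits)
  have iff: "map h xs \<in> interp ?B r \<longleftrightarrow> xs \<in> interp ?A r" if "set xs \<subseteq> universe ?A" for r xs
    unfolding interp using that over by (intro map_mem_image_iff[OF h]) (auto simp: UA)
  have sat: "sat ?B e' \<phi> \<longleftrightarrow> sat ?A e \<phi>"
    if "\<forall>x \<in> free_vars \<phi>. e x \<in> universe ?A \<and> e' x = h (e x)" for \<phi> e e'
    using sat_image[OF h[folded UA] UB, of \<phi> e e'] iff that by blast
  have dom: "sat ?B (\<lambda>_. h a) (dom_formula ?I) \<longleftrightarrow> sat ?A (\<lambda>_. a) (dom_formula ?I)"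
    if "a \<in> universe \<AA>" for a
    using that by (intro sat) (auto simp: UA)
  have iu: "interpreted_universe ?I ?B = h ` interpreted_universe ?I ?A"
    using dom unfolding interpreted_universe_def UB UA by auto
  have sub: "interpreted_universe ?I ?A \<subseteq> universe \<AA>"
    by (auto simp: interpreted_universe_def UA)
  have rel: "sat ?B (\<lambda>i. map h xs ! i) (rel_formula ?I r) \<longleftrightarrow> sat ?A (\<lambda>i. xs ! i) (rel_formula ?I r)"
    if "set xs \<subseteq> universe \<AA>" "\<Gamma> r = Some (length xs)" for xs r
  proof (rule sat, intro ballI)
    fix x assume "x \<in> free_vars (rel_formula ?I r)"
    then have "x < length xs"
      using T that(2) unfolding is_transduction_def is_interpretation_def by blast
    then show "xs ! x \<in> universe ?A \<and> map h xs ! x = h (xs ! x)"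
      using that(1) by (auto simp: UA)
  qed
  have "{xs. set xs \<subseteq> h ` interpreted_universe ?I ?A \<and> \<Gamma> r = Some (length xs) \<and> sat ?B (\<lambda>i. xs ! i) (rel_formula ?I r)}
      = map h ` {xs. set xs \<subseteq> interpreted_universe ?I ?A \<and> \<Gamma> r = Some (length xs) \<and> sat ?A (\<lambda>i. xs ! i) (rel_formula ?I r)}"
    (is "?X = ?Y") for r
  proof (intro equalityI subsetI)
    fix xs assume xs: "xs \<in> ?X"
    then have "xs \<in> lists (h ` interpreted_universe ?I ?A)" by (simp add: lists_eq_set)
    then obtain ys where ys: "xs = map h ys" "set ys \<subseteq> interpreted_universe ?I ?A"
      unfolding lists_image by (auto simp: lists_eq_set)
    then show "xs \<in> ?Y" using xs sub rel[of ys r] by (intro image_eqI[of _ _ ys]) auto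
  next
    fix xs assume "xs \<in> ?Y"
    then show "xs \<in> ?X" using sub rel[of _ r] by fastforce
  qed
  then show ?thesis
    unfolding transduce_marked_def apply_scheme_def iu by (simp add: map_structure_def)
qed

lemma map_structure_comp: "map_structure g (map_structure h \<AA>) = map_structure (g \<circ> h) \<AA>"
  by (simp add: map_structure_def image_image)

lemma map_structure_ident:
  assumes "structure_over \<Sigma> \<AA>" "\<And>x. x \<in> universe \<AA> \<Longrightarrow> h x = x"
  shows "map_structure h \<AA> = \<AA>"
proof -
  have "h ` universe \<AA> = universe \<AA>" using assms(2) by force
  moreover have "map h xs = xs" if "xs \<in> interp \<AA> r" for xs r
    using assms that unfolding structure_over_def by (auto intro!: map_idI)
  then have "map h ` interp \<AA> r = interp \<AA> r" for r by force
  ultimately show ?thesis by (simp add: map_structure_def)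
qed

lemma map_structure_poset:
  assumes "r \<subseteq> A \<times> A"
  shows "map_structure h (poset_structure A r) = poset_structure (h ` A) (map_prod h h ` r)"
proof -
  have "map h ` {[a, b] |a b. a \<in> A \<and> b \<in> A \<and> (a, b) \<in> r}
      = {[a, b] |a b. a \<in> h ` A \<and> b \<in> h ` A \<and> (a, b) \<in> map_prod h h ` r}" (is "?X = ?Y")
  proof (intro equalityI subsetI)
    fix x assume "x \<in> ?Y"
    then obtain a b where "x = map h [a, b]" "(a, b) \<in> r" by auto
    then show "x \<in> ?X" using assms by blast
  qed force
  then show ?thesis by (simp add: map_structure_def poset_structure_def)
qed

lemma finite_poset_image:
  assumes "finite_poset A r" "r \<subseteq> A \<times> A" "inj_on h A"
  shows "finite_poset (h ` A) (map_prod h h ` r)"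
proof -
  have r: "refl_on A r" "trans r" "antisym r"
    using assms(1) by (auto simp: finite_poset_def partial_order_on_def preorder_on_def)
  have eq: "x = y" if "x \<in> A" "y \<in> A" "h x = h y" for x y using that assms(3) by (auto simp: inj_on_def)
  have "trans (map_prod h h ` r)"
  proof (rule transI)
    fix x y z assume "(x, y) \<in> map_prod h h ` r" "(y, z) \<in> map_prod h h ` r"
    then obtain a b c d where *: "(a, b) \<in> r" "(c, d) \<in> r" "x = h a" "y = h b" "y = h c" "z = h d"
      by auto
    then have "b = c" using assms(2) by (intro eq) auto
    then have "(a, d) \<in> r" using * r(2) by (auto dest: transD)
    then show "(x, z) \<in> map_prod h h ` r" using * by auto
  qed
  moreover have "antisym (map_prod h h ` r)"
  proof (rule antisymI)
    fix x y assume "(x, y) \<in> map_prod h h ` r" "(y, x) \<in> map_prod h h ` r"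
    then obtain a b c d where *: "(a, b) \<in> r" "(c, d) \<in> r" "x = h a" "y = h b" "y = h c" "x = h d"
      by auto
    then have "b = c" "a = d" using assms(2) by (auto intro!: eq)
    then show "x = y" using * r(3) by (auto dest: antisymD)
  qed
  moreover have "refl_on (h ` A) (map_prod h h ` r)"
    using r(1) by (auto simp: refl_on_def)
  moreover have "map_prod h h ` r \<subseteq> h ` A \<times> h ` A" using assms(2) by auto
  ultimately show ?thesis
    using assms(1) by (simp add: finite_poset_def partial_order_on_def preorder_on_def)
qed

lemma poset_width_le:
  assumes "finite A" "\<And>X. antichain_in A r X \<Longrightarrow> card X \<le> w"
  shows "poset_width A r \<le> w"
proof -
  have "{card X | X. antichain_in A r X} \<subseteq> {..w}" using assms(2) by auto
  moreover from this have "finite {card X | X. antichain_in A r X}" by (rule finite_subset) simp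
  moreover have "antichain_in A r {}" by (simp add: antichain_in_def)
  ultimately show ?thesis unfolding poset_width_def by (subst Max_le_iff) auto
qed

text \<open>Choose one preimage for each element of \<open>X\<close>; a comparability between
  preimages would be carried over to \<open>X\<close> by \<open>h\<close>.\<close>

lemma antichain_in_image:
  assumes "antichain_in (h ` A) (map_prod h h ` r) X"
  obtains Y where "antichain_in A r Y" "X = h ` Y"
proof
  let ?Y = "inv_into A h ` X"
  have X: "X \<subseteq> h ` A" using assms by (simp add: antichain_in_def)
  have h: "h (inv_into A h x) = x" if "x \<in> X" for x using that X by (blast intro: f_inv_into_f)
  show "X = h ` ?Y" using image_inv_into_cancel[OF refl X] by simp
  have "?Y \<subseteq> A" using X by (auto intro!: inv_into_into)
  moreover have "(inv_into A h x, inv_into A h y) \<notin> r" if "x \<in> X" "y \<in> X" "x \<noteq> y" for x y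
  proof
    assume "(inv_into A h x, inv_into A h y) \<in> r"
    then have "(h (inv_into A h x), h (inv_into A h y)) \<in> map_prod h h ` r" by (rule map_prod_imageI)
    then have "(x, y) \<in> map_prod h h ` r" using h that by simp
    with assms that show False by (auto simp: antichain_in_def)
  qed
  ultimately show "antichain_in A r ?Y" unfolding antichain_in_def by blast
qed

section \<open>The poset of a mixed-thin witness\<close>

primrec pairs :: "nat \<Rightarrow> (nat \<times> nat) list" where
  "pairs 0 = []"
| "pairs (Suc k) = pairs k @ map (\<lambda>i. (i, Suc k)) [1..<Suc k]"

lemma length_pairs: "length (pairs k) = k choose 2"
  by (induction k) (simp_all add: numeral_2_eq_2 del: upt_Suc)

lemma set_pairs: "set (pairs k) = {(i, j). 1 \<le> i \<and> i < j \<and> j \<le> k}"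
proof (induction k)
  case (Suc k)
  have "{(i, j). 1 \<le> i \<and> i < j \<and> j \<le> Suc k} =
      {(i, j). 1 \<le> i \<and> i < j \<and> j \<le> k} \<union> (\<lambda>i. (i, Suc k)) ` {1..<Suc k}"
    by (auto simp: image_iff)
  then show ?case using Suc.IH by (simp del: upt_Suc)
qed auto

lemma nth_pairs:
  assumes "c < length (pairs k)"
  obtains i j where "pairs k ! c = (i, j)" "1 \<le> i" "i < j" "j \<le> k"
  using nth_mem[OF assms] unfolding set_pairs by auto

definition num_blocks :: "nat \<Rightarrow> nat" where
  "num_blocks k = length (pairs k) + 2"

text \<open>Conditions (b) and (c) for one pair of parts, with the edge set as a parameter so that
  they can be tested on \<open>E\<close> alone.\<close>

definition fits :: "'a set set \<Rightarrow> 'a set \<Rightarrow> 'a set \<Rightarrow> 'a rel \<Rightarrow> bool" where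
  "fits F A B R \<longleftrightarrow>
     (\<forall>u v w. (({u, v} \<subseteq> A \<and> w \<in> B) \<or> ({u, v} \<subseteq> B \<and> w \<in> A)) \<and>
        u \<noteq> v \<and> (u, v) \<in> R \<and> v \<noteq> w \<and> (v, w) \<in> R \<and> {u, w} \<in> F \<longrightarrow> {v, w} \<in> F) \<and>
     (\<forall>u v w. (({v, w} \<subseteq> A \<and> u \<in> B) \<or> ({v, w} \<subseteq> B \<and> u \<in> A)) \<and>
        u \<noteq> v \<and> (u, v) \<in> R \<and> v \<noteq> w \<and> (v, w) \<in> R \<and> {u, w} \<in> F \<longrightarrow> {u, v} \<in> F)"

lemma fits_left:
  assumes "fits F A B R" "{u, v} \<subseteq> A \<and> w \<in> B \<or> {u, v} \<subseteq> B \<and> w \<in> A" "u \<noteq> v" "(u, v) \<in> R"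
    "v \<noteq> w" "(v, w) \<in> R" "{u, w} \<in> F"
  shows "{v, w} \<in> F"
  using assms(1)[unfolded fits_def, THEN conjunct1, rule_format, of u v w] assms(2-) by blast

lemma fits_right:
  assumes "fits F A B R" "{v, w} \<subseteq> A \<and> u \<in> B \<or> {v, w} \<subseteq> B \<and> u \<in> A" "u \<noteq> v" "(u, v) \<in> R"
    "v \<noteq> w" "(v, w) \<in> R" "{u, w} \<in> F"
  shows "{u, v} \<in> F"
  using assms(1)[unfolded fits_def, THEN conjunct2, rule_format, of v w u] assms(2-) by blast

text \<open>
  The poset has the elements \<open>(c, u)\<close> for a block number \<open>c\<close> and a vertex \<open>u\<close>.  Block \<open>0\<close> consists
  of the vertices themselves, \<open>(1, u)\<close> plays the role of the right end of the interval of \<open>u\<close> in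
  the proper interval graph on its own part, and block \<open>c + 2\<close> contains a copy of the two parts
  of the pair number \<open>c\<close>, ordered by \<open>L i j\<close> restricted to elements of the same part and
  non-neighbours.  The vertices outside of both parts form a further chain of that block.
\<close>

locale mixed_thin =
  fixes k :: nat and V :: "'a set" and E P L and W :: "'a rel"
  assumes graph: "simple_graph V E" and witness: "mixed_thin_witness k V E P L"
    and W: "linear_order_on V W"
begin

text \<open>If \<open>E\<close> fails the conditions, the set chosen by the witness can only be the
  complement; so this test on \<open>E\<close> always yields an admissible choice.\<close>

definition flag :: "nat \<Rightarrow> nat \<Rightarrow> bool" where
  "flag i j \<longleftrightarrow> fits E (P i) (P j) (L i j)"

text \<open>Non-membership in the set selected by the flag. This reading holds for distinct
  \<open>u\<close> and \<open>v\<close> only, which is why inequalities accompany it below.\<close>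

definition apart :: "nat \<Rightarrow> nat \<Rightarrow> 'a \<Rightarrow> 'a \<Rightarrow> bool" where
  "apart i j u v \<longleftrightarrow> ({u, v} \<in> E) \<noteq> flag i j"

definition below :: "'a \<Rightarrow> 'a \<Rightarrow> bool" where
  "below u v \<longleftrightarrow> (\<exists>i \<in> {1..k}. u \<in> P i \<and> v \<in> P i \<and> (u, v) \<in> L i i)"

definition far_below :: "'a \<Rightarrow> 'a \<Rightarrow> bool" where
  "far_below u v \<longleftrightarrow> (\<exists>i \<in> {1..k}. u \<in> P i \<and> v \<in> P i \<and> (u, v) \<in> L i i \<and> u \<noteq> v \<and> apart i i u v)"

text \<open>In terms of intervals, only a step from a right end (block 1) to a left end (block 0)
  requires the two intervals to be disjoint; every other step just follows the order of the
  part.\<close>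

definition base :: "nat \<Rightarrow> nat \<Rightarrow> 'a \<Rightarrow> 'a \<Rightarrow> bool" where
  "base c d u v \<longleftrightarrow> (if c = 1 \<and> d = 0 then far_below u v else below u v)"

definition cross :: "nat \<times> nat \<Rightarrow> 'a \<Rightarrow> 'a \<Rightarrow> bool" where
  "cross p u v \<longleftrightarrow> (case p of (i, j) \<Rightarrow>
     u \<in> P i \<union> P j \<and> v \<in> P i \<union> P j \<and> (u, v) \<in> L i j \<and> ((u \<in> P i \<longleftrightarrow> v \<in> P i) \<or> apart i j u v) \<or>
     u \<notin> P i \<union> P j \<and> v \<notin> P i \<union> P j \<and> (u, v) \<in> W)"

definition inside :: "nat \<times> nat \<Rightarrow> 'a set" where
  "inside p = (case p of (i, j) \<Rightarrow> P i \<union> P j)"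

text \<open>Between blocks 0 or 1 and a copy, the relation is generated by putting
  \<open>(0, w)\<close> below its own copy \<open>(d, w)\<close> for \<open>w\<close> inside the
  pair; the existential quantifier closes this under composition with \<open>base\<close> and
  \<open>cross\<close>.\<close>

definition ord :: "nat \<Rightarrow> nat \<Rightarrow> 'a \<Rightarrow> 'a \<Rightarrow> bool" where
  "ord c d u v \<longleftrightarrow>
     (if c < 2 then
        if d < 2 then base c d u v
        else \<exists>w \<in> inside (pairs k ! (d - 2)). base c 0 u w \<and> cross (pairs k ! (d - 2)) w v
      else c = d \<and> cross (pairs k ! (c - 2)) u v)"

definition elems :: "(nat \<times> 'a) set" where
  "elems = {..<num_blocks k} \<times> V"

definition order :: "(nat \<times> 'a) rel" where
  "order = {((c, u), (d, v)). (c, u) \<in> elems \<and> (d, v) \<in> elems \<and> ord c d u v}"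

section \<open>Consequences of the witness conditions\<close>

lemma parts: "(\<Union>i \<in> {1..k}. P i) = V"
  using witness unfolding mixed_thin_witness_def by (elim conjE)

lemma disjoint_parts: "disjoint_family_on P {1..k}"
  using witness unfolding mixed_thin_witness_def by (elim conjE)

lemma linear: "1 \<le> i \<Longrightarrow> i \<le> j \<Longrightarrow> j \<le> k \<Longrightarrow> linear_order_on (P i \<union> P j) (L i j)"
  using witness unfolding mixed_thin_witness_def by (elim conjE) simp

lemma part_eq: "u \<in> P i \<Longrightarrow> u \<in> P j \<Longrightarrow> i \<in> {1..k} \<Longrightarrow> j \<in> {1..k} \<Longrightarrow> i = j"
  using disjoint_parts unfolding disjoint_family_on_def by blast

lemma part_subset: "i \<in> {1..k} \<Longrightarrow> P i \<subseteq> V"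
  using parts by auto

lemma obtain_part:
  assumes "u \<in> V" obtains i where "i \<in> {1..k}" "u \<in> P i"
  using assms parts by auto

lemma witness_pair:
  assumes "1 \<le> i" "i \<le> j" "j \<le> k"
  shows L_restrict: "u \<in> P i \<Longrightarrow> v \<in> P i \<Longrightarrow> (u, v) \<in> L i j \<longleftrightarrow> (u, v) \<in> L i i"
      "u \<in> P j \<Longrightarrow> v \<in> P j \<Longrightarrow> (u, v) \<in> L i j \<longleftrightarrow> (u, v) \<in> L j j"
    and ex_fits: "\<exists>F. fits F (P i) (P j) (L i j) \<and>
      (\<forall>u \<in> V. \<forall>v \<in> V. u \<noteq> v \<longrightarrow> ({u, v} \<in> F \<longleftrightarrow> \<not> apart i j u v))"
proof -
  let ?C = "\<lambda>F i j. F i j \<in> {E, [V]\<^bsup>2\<^esup> - E} \<and> L i j \<inter> (P i \<times> P i) = L i i \<and>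
     L i j \<inter> (P j \<times> P j) = L j j \<and> fits (F i j) (P i) (P j) (L i j)"
  have "\<exists>F. \<forall>i j. 1 \<le> i \<and> i \<le> j \<and> j \<le> k \<longrightarrow> ?C F i j"
    using witness unfolding mixed_thin_witness_def fits_def by (elim conjE)
  then obtain F where "\<forall>i j. 1 \<le> i \<and> i \<le> j \<and> j \<le> k \<longrightarrow> ?C F i j" ..
  then have "\<forall>j. 1 \<le> i \<and> i \<le> j \<and> j \<le> k \<longrightarrow> ?C F i j" by (rule spec)
  then have "1 \<le> i \<and> i \<le> j \<and> j \<le> k \<longrightarrow> ?C F i j" by (rule spec)
  then have C: "?C F i j" by (rule mp) (use assms in simp)
  note F = C[THEN conjunct1] C[THEN conjunct2, THEN conjunct1]
    C[THEN conjunct2, THEN conjunct2, THEN conjunct1] C[THEN conjunct2, THEN conjunct2, THEN conjunct2]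
  show "u \<in> P i \<Longrightarrow> v \<in> P i \<Longrightarrow> (u, v) \<in> L i j \<longleftrightarrow> (u, v) \<in> L i i"
    "u \<in> P j \<Longrightarrow> v \<in> P j \<Longrightarrow> (u, v) \<in> L i j \<longleftrightarrow> (u, v) \<in> L j j"
    using F(2,3) by auto
  \<comment> \<open>\<open>E\<close> is taken whenever it fits, even if the witness chose the
    complement.\<close>
  show "\<exists>F. fits F (P i) (P j) (L i j) \<and>
      (\<forall>u \<in> V. \<forall>v \<in> V. u \<noteq> v \<longrightarrow> ({u, v} \<in> F \<longleftrightarrow> \<not> apart i j u v))"
  proof (cases "flag i j")
    case True
    then show ?thesis by (intro exI[of _ E]) (simp add: apart_def flag_def)
  next
    case False
    then have "F i j \<noteq> E" using F(4) unfolding flag_def by metis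
    then have "F i j = [V]\<^bsup>2\<^esup> - E" using F(1) by blast
    moreover have "{u, v} \<in> [V]\<^bsup>2\<^esup>" if "u \<in> V" "v \<in> V" "u \<noteq> v" for u v
      using that by (auto simp: nsets_def)
    ultimately show ?thesis using F(4) False by (intro exI[of _ "F i j"]) (simp add: apart_def)
  qed
qed

lemma apart_commute: "apart i j u v \<longleftrightarrow> apart i j v u"
  by (simp add: apart_def insert_commute)

lemma order_on_parts:
  assumes "1 \<le> i" "i \<le> j" "j \<le> k"
  shows L_refl: "u \<in> P i \<union> P j \<Longrightarrow> (u, u) \<in> L i j"
    and L_trans: "(u, v) \<in> L i j \<Longrightarrow> (v, w) \<in> L i j \<Longrightarrow> (u, w) \<in> L i j"
    and L_antisym: "(u, v) \<in> L i j \<Longrightarrow> (v, u) \<in> L i j \<Longrightarrow> u = v"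
    and L_total: "u \<in> P i \<union> P j \<Longrightarrow> v \<in> P i \<union> P j \<Longrightarrow> (u, v) \<in> L i j \<or> (v, u) \<in> L i j"
proof -
  have *: "refl_on (P i \<union> P j) (L i j)" "trans (L i j)" "antisym (L i j)" "total_on (P i \<union> P j) (L i j)"
    using linear[OF assms] by (auto simp: linear_order_on_def partial_order_on_def preorder_on_def)
  show "u \<in> P i \<union> P j \<Longrightarrow> (u, u) \<in> L i j" using *(1) by (simp add: refl_on_def)
  show "(u, v) \<in> L i j \<Longrightarrow> (v, w) \<in> L i j \<Longrightarrow> (u, w) \<in> L i j" using *(2) by (meson transD)
  show "(u, v) \<in> L i j \<Longrightarrow> (v, u) \<in> L i j \<Longrightarrow> u = v" using *(3) by (meson antisymD)
  show "u \<in> P i \<union> P j \<Longrightarrow> v \<in> P i \<union> P j \<Longrightarrow> (u, v) \<in> L i j \<or> (v, u) \<in> L i j"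
    using *(1,4) unfolding total_on_def refl_on_def by metis
qed

lemma W_order:
  shows W_refl: "u \<in> V \<Longrightarrow> (u, u) \<in> W"
    and W_trans: "(u, v) \<in> W \<Longrightarrow> (v, w) \<in> W \<Longrightarrow> (u, w) \<in> W"
    and W_antisym: "(u, v) \<in> W \<Longrightarrow> (v, u) \<in> W \<Longrightarrow> u = v"
    and W_total: "u \<in> V \<Longrightarrow> v \<in> V \<Longrightarrow> (u, v) \<in> W \<or> (v, u) \<in> W"
proof -
  have *: "refl_on V W" "trans W" "antisym W" "total_on V W"
    using W by (auto simp: linear_order_on_def partial_order_on_def preorder_on_def)
  show "u \<in> V \<Longrightarrow> (u, u) \<in> W" using *(1) by (simp add: refl_on_def)
  show "(u, v) \<in> W \<Longrightarrow> (v, w) \<in> W \<Longrightarrow> (u, w) \<in> W" using *(2) by (meson transD)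
  show "(u, v) \<in> W \<Longrightarrow> (v, u) \<in> W \<Longrightarrow> u = v" using *(3) by (meson antisymD)
  show "u \<in> V \<Longrightarrow> v \<in> V \<Longrightarrow> (u, v) \<in> W \<or> (v, u) \<in> W"
    using *(1,4) unfolding total_on_def refl_on_def by metis
qed

text \<open>The contrapositives of (b) and (c). One of the two steps may be trivial here, which
  spares the transitivity proofs a split into strict and reflexive steps. Antisymmetry gives
  \<open>u \<noteq> w\<close>, without which \<open>apart\<close> could not be read as
  non-membership.\<close>

lemma apart_extend:
  assumes ij: "1 \<le> i" "i \<le> j" "j \<le> k" and L: "(u, v) \<in> L i j" "(v, w) \<in> L i j"
  shows apart_left: "{u, v} \<subseteq> P i \<and> w \<in> P j \<or> {u, v} \<subseteq> P j \<and> w \<in> P i \<Longrightarrow> v \<noteq> w \<Longrightarrow>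
      apart i j v w \<Longrightarrow> apart i j u w"
    and apart_right: "{v, w} \<subseteq> P i \<and> u \<in> P j \<or> {v, w} \<subseteq> P j \<and> u \<in> P i \<Longrightarrow> u \<noteq> v \<Longrightarrow>
      apart i j u v \<Longrightarrow> apart i j u w"
proof -
  obtain F where F: "fits F (P i) (P j) (L i j)"
    and iff: "\<And>u v. u \<in> V \<Longrightarrow> v \<in> V \<Longrightarrow> u \<noteq> v \<Longrightarrow> {u, v} \<in> F \<longleftrightarrow> \<not> apart i j u v"
    using ex_fits[OF ij] by blast
  have sub: "P i \<subseteq> V" "P j \<subseteq> V" using ij by (auto intro!: part_subset)
  have uw: "u \<noteq> w" if "u \<noteq> v \<or> v \<noteq> w" using that L L_antisym[OF ij] by blast
  show "apart i j u w" if *: "{u, v} \<subseteq> P i \<and> w \<in> P j \<or> {u, v} \<subseteq> P j \<and> w \<in> P i" "v \<noteq> w" "apart i j v w"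
  proof (cases "u = v")
    case False
    have "u \<in> V" "v \<in> V" "w \<in> V" using *(1) sub by auto
    with *(2,3) iff have "{v, w} \<notin> F" by blast
    then have "{u, w} \<notin> F" using fits_left[OF F] L *(1,2) False by blast
    then show ?thesis using iff[of u w] uw *(2) \<open>u \<in> V\<close> \<open>w \<in> V\<close> by blast
  qed (use * in simp)
  show "apart i j u w" if *: "{v, w} \<subseteq> P i \<and> u \<in> P j \<or> {v, w} \<subseteq> P j \<and> u \<in> P i" "u \<noteq> v" "apart i j u v"
  proof (cases "v = w")
    case False
    have "u \<in> V" "v \<in> V" "w \<in> V" using *(1) sub by auto
    with *(2,3) iff have "{u, v} \<notin> F" by blast
    then have "{u, w} \<notin> F" using fits_right[OF F] L *(1,2) False by blast
    then show ?thesis using iff[of u w] uw *(2) \<open>u \<in> V\<close> \<open>w \<in> V\<close> by blast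
  qed (use * in simp)
qed

section \<open>The partial order on the blocks\<close>

lemma below_refl:
  assumes "u \<in> V" shows "below u u"
proof -
  obtain i where "i \<in> {1..k}" "u \<in> P i" using assms by (rule obtain_part)
  then show ?thesis using L_refl[of i i u] by (auto simp: below_def)
qed

lemma below_part:
  assumes "below u v" "i \<in> {1..k}" "u \<in> P i \<or> v \<in> P i"
  shows "u \<in> P i" "v \<in> P i" "(u, v) \<in> L i i"
proof -
  obtain j where "j \<in> {1..k}" "u \<in> P j" "v \<in> P j" "(u, v) \<in> L j j"
    using assms(1) by (auto simp: below_def)
  moreover from this have "j = i" using part_eq assms(2,3) by blast
  ultimately show "u \<in> P i" "v \<in> P i" "(u, v) \<in> L i i" by simp_all
qed

lemma below_trans:
  assumes "below u v" "below v w" shows "below u w"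
proof -
  obtain i where i: "i \<in> {1..k}" "u \<in> P i" "v \<in> P i" "(u, v) \<in> L i i"
    using assms(1) by (auto simp: below_def)
  with assms(2) have "w \<in> P i" "(v, w) \<in> L i i" by (auto dest: below_part)
  then show ?thesis using i L_trans[of i i u v w] by (auto simp: below_def)
qed

lemma below_antisym:
  assumes "below u v" "below v u" shows "u = v"
proof -
  obtain i where i: "i \<in> {1..k}" "u \<in> P i" "v \<in> P i" "(u, v) \<in> L i i"
    using assms(1) by (auto simp: below_def)
  with assms(2) have "(v, u) \<in> L i i" by (auto dest: below_part)
  then show ?thesis using i L_antisym[of i i u v] by auto
qed

lemma far_below_imp_below: "far_below u v \<Longrightarrow> below u v"
  unfolding below_def far_below_def by blast

lemma far_below_neq: "far_below u v \<Longrightarrow> u \<noteq> v"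
  unfolding far_below_def by blast

text \<open>If the interval of \<open>v\<close> ends before that of \<open>w\<close> begins, so does
  every earlier interval. All vertices lie in one part, so the side conditions of (b) hold with
  \<open>i = j\<close>.\<close>

lemma below_far_below:
  assumes "below u v" "far_below v w" shows "far_below u w"
proof -
  obtain i where i: "i \<in> {1..k}" "v \<in> P i" "w \<in> P i" "(v, w) \<in> L i i" "v \<noteq> w" "apart i i v w"
    using assms(2) unfolding far_below_def by blast
  have u: "u \<in> P i" "(u, v) \<in> L i i" using below_part[OF assms(1) i(1)] i(2) by auto
  have ii: "1 \<le> i" "i \<le> i" "i \<le> k" using i by auto
  have "apart i i u w" using apart_left[OF ii u(2) i(4)] u i by blast
  moreover have "(u, w) \<in> L i i" using L_trans[OF ii u(2) i(4)] .
  moreover have "u \<noteq> w" using L_antisym[OF ii u(2)] i by blast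
  ultimately show ?thesis using i u unfolding far_below_def by blast
qed

lemma far_below_below:
  assumes "far_below u v" "below v w" shows "far_below u w"
proof -
  obtain i where i: "i \<in> {1..k}" "u \<in> P i" "v \<in> P i" "(u, v) \<in> L i i" "u \<noteq> v" "apart i i u v"
    using assms(1) unfolding far_below_def by blast
  have w: "w \<in> P i" "(v, w) \<in> L i i" using below_part[OF assms(2) i(1)] i(3) by auto
  have ii: "1 \<le> i" "i \<le> i" "i \<le> k" using i by auto
  have "apart i i u w" using apart_right[OF ii i(4) w(2)] w i by blast
  moreover have "(u, w) \<in> L i i" using L_trans[OF ii i(4) w(2)] .
  moreover have "u \<noteq> w" using L_antisym[OF ii i(4)] w i by blast
  ultimately show ?thesis using i w unfolding far_below_def by blast
qed

lemma base_imp_below: "base c d u v \<Longrightarrow> below u v"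
  using far_below_imp_below by (auto simp: base_def split: if_splits)

text \<open>A path from block 1 to block 0 through blocks 0 and 1 contains a step from 1 to 0, and a
  \<open>far_below\<close> step stays one when it is extended on either side by
  \<open>below\<close>.\<close>

lemma base_trans:
  assumes "base c d u v" "base d e v w" "d < 2" shows "base c e u w"
proof (cases "c = 1 \<and> e = 0")
  case True
  have "far_below u w"
  proof (cases "d = 0")
    case d: True
    then have "far_below u v" using assms(1) True by (simp add: base_def)
    then show ?thesis using base_imp_below[OF assms(2)] by (rule far_below_below)
  next
    case False
    then have "far_below v w" using assms(2,3) True by (simp add: base_def)
    with base_imp_below[OF assms(1)] show ?thesis by (rule below_far_below)
  qed
  then show ?thesis using True by (simp add: base_def)
next
  case False
  then show ?thesis using below_trans[OF assms(1,2)[THEN base_imp_below]] by (auto simp: base_def)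
qed

lemma base_antisym:
  assumes "base c d u v" "base d c v u" "c < 2" "d < 2"
  shows "c = d \<and> u = v"
proof -
  have uv: "u = v" using below_antisym[OF assms(1,2)[THEN base_imp_below]] .
  moreover have "\<not> (c = 1 \<and> d = 0)" "\<not> (d = 1 \<and> c = 0)"
    using assms(1,2) far_below_neq[of u u] uv by (auto simp: base_def split: if_splits)
  ultimately show ?thesis using assms(3,4) by auto
qed

lemma cross_refl:
  assumes "1 \<le> i" "i \<le> j" "j \<le> k" "u \<in> V" shows "cross (i, j) u u"
  using assms L_refl[OF assms(1-3)] W_refl by (auto simp: cross_def)

text \<open>Only the case of \<open>u\<close> and \<open>w\<close> in different parts is critical.
  Then \<open>v\<close> shares its part with one of them, so the other step joins different parts
  and is \<open>apart\<close>; (b) or (c) carries this over to the longer pair.\<close>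

lemma cross_trans:
  assumes ij: "1 \<le> i" "i < j" "j \<le> k" and "cross (i, j) u v" "cross (i, j) v w"
  shows "cross (i, j) u w"
proof (cases "v \<in> P i \<union> P j")
  case True
  have ij': "1 \<le> i" "i \<le> j" "j \<le> k" using ij by auto
  have *: "u \<in> P i \<union> P j" "w \<in> P i \<union> P j" "(u, v) \<in> L i j" "(v, w) \<in> L i j"
    "(u \<in> P i \<longleftrightarrow> v \<in> P i) \<or> apart i j u v" "(v \<in> P i \<longleftrightarrow> w \<in> P i) \<or> apart i j v w"
    using assms(4,5) True by (auto simp: cross_def)
  have "apart i j u w" if uw: "(u \<in> P i) \<noteq> (w \<in> P i)"
  proof (cases "u \<in> P i \<longleftrightarrow> v \<in> P i")
    case T: True
    then have "apart i j v w" "v \<noteq> w" using uw * by auto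
    with apart_left[OF ij' *(3,4)] show ?thesis using T uw *(1,2) True by blast
  next
    case False
    then have "apart i j u v" "u \<noteq> v" using * by auto
    with apart_right[OF ij' *(3,4)] show ?thesis using False uw *(1,2) True by blast
  qed
  then show ?thesis using * L_trans[OF ij' *(3,4)] by (auto simp: cross_def)
next
  case False
  then show ?thesis using assms(4,5) W_trans by (auto simp: cross_def)
qed

lemma cross_antisym:
  assumes "1 \<le> i" "i \<le> j" "j \<le> k" shows "cross (i, j) u v \<Longrightarrow> cross (i, j) v u \<Longrightarrow> u = v"
  using L_antisym[OF assms] W_antisym by (auto simp: cross_def)

lemma block_pair:
  assumes "2 \<le> c" "c < num_blocks k"
  obtains i j where "pairs k ! (c - 2) = (i, j)" "1 \<le> i" "i < j" "j \<le> k"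
proof -
  have lt: "c - 2 < length (pairs k)" using assms by (simp add: num_blocks_def)
  show thesis by (rule nth_pairs[OF lt]) (rule that)
qed

lemma ord_cases:
  assumes "ord c d u v"
  obtains "c < 2" "d < 2" "base c d u v"
  | w where "c < 2" "2 \<le> d" "w \<in> inside (pairs k ! (d - 2))" "base c 0 u w" "cross (pairs k ! (d - 2)) w v"
  | "2 \<le> c" "c = d" "cross (pairs k ! (c - 2)) u v"
proof (cases "c < 2")
  case True
  then show thesis using assms that by (cases "d < 2") (auto simp: ord_def)
next
  case False
  then show thesis using assms that by (auto simp: ord_def)
qed

text \<open>No step leaves a copy. So the steps among blocks 0 and 1 come first and are merged by
  \<open>base_trans\<close>, and the steps within the copy come last and are merged by
  \<open>cross_trans\<close>.\<close>

lemma ord_trans: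
  assumes "ord c d u v" "ord d e v w" "e < num_blocks k"
  shows "ord c e u w"
proof -
  have ct: "cross (pairs k ! (e - 2)) x z"
    if "2 \<le> e" "cross (pairs k ! (e - 2)) x y" "cross (pairs k ! (e - 2)) y z" for x y z
  proof -
    from that(1) assms(3) obtain i j where "pairs k ! (e - 2) = (i, j)" "1 \<le> i" "i < j" "j \<le> k"
      by (rule block_pair)
    then show ?thesis using that(2,3) cross_trans[of i j x y z] by simp
  qed
  from assms(2) show ?thesis
  proof (cases rule: ord_cases)
    case 1
    with assms(1) have "c < 2" "base c d u v" by (auto simp: ord_def split: if_splits)
    then show ?thesis using 1 base_trans[of c d u v e w] by (simp add: ord_def)
  next
    case (2 x)
    with assms(1) have "c < 2" "base c d u v" by (auto simp: ord_def split: if_splits)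
    moreover from this have "base c 0 u x" using base_trans[of c d u v 0 x] 2 by simp
    ultimately show ?thesis using 2 by (auto simp: ord_def)
  next
    case 3
    from assms(1) show ?thesis
    proof (cases rule: ord_cases)
      case 1
      then show ?thesis using 3 by simp
    next
      case (2 x)
      then have "cross (pairs k ! (e - 2)) x w" using 3 ct[of x v w] by simp
      then show ?thesis using 2 3 by (auto simp: ord_def)
    next
      case same: 3
      then have "cross (pairs k ! (e - 2)) u w" using 3 ct[of u v w] by simp
      then show ?thesis using 3 same by (simp add: ord_def)
    qed
  qed
qed

lemma ord_antisym:
  assumes "ord c d u v" "ord d c v u" "d < num_blocks k"
  shows "c = d \<and> u = v"
  using assms(1)
proof (cases rule: ord_cases)
  case 1
  then show ?thesis using assms(2) base_antisym[of c d u v] by (simp add: ord_def)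
next
  case (2 x)
  then show ?thesis using assms(2) by (simp add: ord_def)
next
  case 3
  then have "2 \<le> c" "c < num_blocks k" using assms(3) by simp_all
  then obtain i j where "pairs k ! (c - 2) = (i, j)" "1 \<le> i" "i < j" "j \<le> k" by (rule block_pair)
  then show ?thesis using 3 assms(2) cross_antisym[of i j u v] by (simp add: ord_def)
qed

lemma ord_refl:
  assumes "u \<in> V" "c < num_blocks k"
  shows "ord c c u u"
proof (cases "c < 2")
  case True
  then show ?thesis using below_refl[OF assms(1)] by (auto simp: ord_def base_def)
next
  case False
  then have "2 \<le> c" by simp
  then obtain i j where "pairs k ! (c - 2) = (i, j)" "1 \<le> i" "i < j" "j \<le> k"
    using assms(2) by (rule block_pair)
  then show ?thesis using False assms(1) cross_refl[of i j u] by (simp add: ord_def)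
qed

lemma finite_V: "finite V"
  using graph by (simp add: simple_graph_def)

lemma order_subset: "order \<subseteq> elems \<times> elems"
  by (auto simp: order_def)

lemma finite_poset: "finite_poset elems order"
proof -
  have "refl_on elems order" using ord_refl by (auto simp: refl_on_def order_def elems_def)
  moreover have "trans order"
    using ord_trans unfolding trans_def order_def elems_def by blast
  moreover have "antisym order"
    using ord_antisym unfolding antisym_def order_def elems_def by blast
  moreover have "finite elems" using finite_V by (simp add: elems_def)
  ultimately show ?thesis
    using order_subset by (simp add: finite_poset_def partial_order_on_def preorder_on_def)
qed

section \<open>Chain decomposition and width\<close>

definition part_of :: "'a \<Rightarrow> nat" where
  "part_of u = (SOME i. i \<in> {1..k} \<and> u \<in> P i)"

lemma part_of: "u \<in> V \<Longrightarrow> part_of u \<in> {1..k} \<and> u \<in> P (part_of u)"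
  unfolding part_of_def by (rule someI_ex) (blast elim: obtain_part)

definition chain_of :: "nat \<times> 'a \<Rightarrow> nat \<times> nat" where
  "chain_of x = (case x of (c, u) \<Rightarrow>
     if c < 2 then (c, part_of u)
     else (c, case pairs k ! (c - 2) of (i, j) \<Rightarrow> if u \<in> P i then 0 else if u \<in> P j then 1 else 2))"

lemma chain_of_comparable:
  assumes "x \<in> elems" "y \<in> elems" "chain_of x = chain_of y"
  shows "(x, y) \<in> order \<or> (y, x) \<in> order"
proof -
  obtain c u d v where xy: "x = (c, u)" "y = (d, v)" by (cases x; cases y)
  have "fst (chain_of (c, u)) = c" "fst (chain_of (d, v)) = d" by (simp_all add: chain_of_def)
  then have d: "d = c" "c < num_blocks k" "u \<in> V" "v \<in> V"
    using assms xy by (auto simp: elems_def)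
  have "ord c c u v \<or> ord c c v u"
  proof (cases "c < 2")
    case True
    then have "part_of u = part_of v" using assms(3) xy d by (simp add: chain_of_def)
    then have "below u v \<or> below v u"
      using part_of[of u] part_of[of v] d L_total[of "part_of u" "part_of u" u v] unfolding below_def by auto
    then show ?thesis using True by (auto simp: ord_def base_def)
  next
    case False
    then have "2 \<le> c" by simp
    then obtain i j where ij: "pairs k ! (c - 2) = (i, j)" "1 \<le> i" "i < j" "j \<le> k"
      using d(2) by (rule block_pair)
    have "(if u \<in> P i then 0 else if u \<in> P j then 1 else 2 :: nat)
        = (if v \<in> P i then 0 else if v \<in> P j then 1 else 2)"
      using assms(3) xy d(1) ij(1) False by (simp add: chain_of_def)
    then have uv: "u \<in> P i \<longleftrightarrow> v \<in> P i" "u \<in> P i \<union> P j \<longleftrightarrow> v \<in> P i \<union> P j"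
      by (auto split: if_splits)
    have "cross (i, j) u v \<or> cross (i, j) v u"
    proof (cases "u \<in> P i \<union> P j")
      case True
      then show ?thesis using uv ij(2-4) L_total[of i j u v] unfolding cross_def by auto
    next
      case False
      then show ?thesis using uv d(3,4) W_total[of u v] unfolding cross_def by auto
    qed
    then show ?thesis using False ij by (auto simp: ord_def)
  qed
  then show ?thesis using assms xy d by (auto simp: order_def)
qed

text \<open>An antichain meets each chain at most once. There are \<open>k\<close> chains in each of
  blocks 0 and 1 and three in every other block, in total
  \<open>2 * k + 3 * (k choose 2)\<close>.\<close>

lemma card_antichain:
  assumes "antichain_in elems order X"
  shows "card X \<le> 5 * (k choose 2) + 2 * k"
proof -
  let ?C = "{..<2::nat} \<times> {1..k} \<union> {2..<num_blocks k} \<times> {..<3::nat}"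
  have X: "X \<subseteq> elems" using assms by (simp add: antichain_in_def)
  have "inj_on chain_of X"
  proof (rule inj_onI)
    fix x y assume xy: "x \<in> X" "y \<in> X" "chain_of x = chain_of y"
    then have "(x, y) \<in> order \<or> (y, x) \<in> order"
      using chain_of_comparable[of x y] X by (meson subsetD)
    moreover have "\<And>a b. a \<in> X \<Longrightarrow> b \<in> X \<Longrightarrow> a \<noteq> b \<Longrightarrow> (a, b) \<notin> order"
      using assms by (simp add: antichain_in_def)
    ultimately show "x = y" using xy(1,2) by metis
  qed
  then have X_eq: "card X = card (chain_of ` X)" by (simp add: card_image)
  have "chain_of x \<in> ?C" if "x \<in> elems" for x
  proof -
    obtain c u where x: "x = (c, u)" "c < num_blocks k" "u \<in> V" using \<open>x \<in> elems\<close> by (auto simp: elems_def)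
    show ?thesis
    proof (cases "c < 2")
      case True
      then show ?thesis using x part_of[OF x(3)] by (simp add: chain_of_def)
    next
      case False
      then show ?thesis using x by (cases "pairs k ! (c - 2)") (simp add: chain_of_def)
    qed
  qed
  then have "chain_of ` X \<subseteq> ?C" using X by blast
  then have "card (chain_of ` X) \<le> card ?C" by (rule card_mono[rotated]) simp
  also have "\<dots> \<le> card ({..<2::nat} \<times> {1..k}) + card ({2..<num_blocks k} \<times> {..<3::nat})"
    by (rule card_Un_le)
  also have "\<dots> = 2 * k + 3 * length (pairs k)"
    by (simp add: num_blocks_def)
  finally show ?thesis using X_eq by (simp add: length_pairs)
qed

end

section \<open>The transduction\<close>

definition Disj :: "'r formula \<Rightarrow> 'r formula \<Rightarrow> 'r formula" where
  "Disj \<phi> \<psi> = Neg (Conj (Neg \<phi>) (Neg \<psi>))"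

definition Iff :: "'r formula \<Rightarrow> 'r formula \<Rightarrow> 'r formula" where
  "Iff \<phi> \<psi> = Disj (Conj \<phi> \<psi>) (Conj (Neg \<phi>) (Neg \<psi>))"

definition Forall :: "nat \<Rightarrow> 'r formula \<Rightarrow> 'r formula" where
  "Forall x \<phi> = Neg (Exi x (Neg \<phi>))"

definition Disjs :: "'r formula list \<Rightarrow> 'r formula" where
  "Disjs \<phi>s = foldr Disj \<phi>s (Neg (Eq 0 0))"

lemma sat_connectives [simp]:
  "sat \<AA> e (Disj \<phi> \<psi>) \<longleftrightarrow> sat \<AA> e \<phi> \<or> sat \<AA> e \<psi>"
  "sat \<AA> e (Iff \<phi> \<psi>) \<longleftrightarrow> (sat \<AA> e \<phi> \<longleftrightarrow> sat \<AA> e \<psi>)"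
  "sat \<AA> e (Forall x \<phi>) \<longleftrightarrow> (\<forall>a \<in> universe \<AA>. sat \<AA> (e(x := a)) \<phi>)"
  by (auto simp: Disj_def Iff_def Forall_def)

lemma sat_Disjs [simp]: "sat \<AA> e (Disjs \<phi>s) \<longleftrightarrow> (\<exists>\<phi> \<in> set \<phi>s. sat \<AA> e \<phi>)"
  by (induction \<phi>s) (simp_all add: Disjs_def)

lemma connectives_over [simp]:
  "formula_over \<Sigma> (Disj \<phi> \<psi>) \<longleftrightarrow> formula_over \<Sigma> \<phi> \<and> formula_over \<Sigma> \<psi>"
  "formula_over \<Sigma> (Iff \<phi> \<psi>) \<longleftrightarrow> formula_over \<Sigma> \<phi> \<and> formula_over \<Sigma> \<psi>"
  "formula_over \<Sigma> (Forall x \<phi>) \<longleftrightarrow> formula_over \<Sigma> \<phi>"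
  by (auto simp: Disj_def Iff_def Forall_def)

lemma Disjs_over [simp]: "formula_over \<Sigma> (Disjs \<phi>s) \<longleftrightarrow> (\<forall>\<phi> \<in> set \<phi>s. formula_over \<Sigma> \<phi>)"
  by (induction \<phi>s) (simp_all add: Disjs_def)

lemma free_vars_connectives [simp]:
  "free_vars (Disj \<phi> \<psi>) = free_vars \<phi> \<union> free_vars \<psi>"
  "free_vars (Iff \<phi> \<psi>) = free_vars \<phi> \<union> free_vars \<psi>"
  "free_vars (Forall x \<phi>) = free_vars \<phi> - {x}"
  by (auto simp: Disj_def Iff_def Forall_def)

text \<open>The variable 0 comes from the false formula \<open>Neg (Eq 0 0)\<close> that stands for
  the empty disjunction.\<close>

lemma free_vars_Disjs [simp]: "free_vars (Disjs \<phi>s) = {0} \<union> (\<Union>\<phi> \<in> set \<phi>s. free_vars \<phi>)"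
  by (induction \<phi>s) (auto simp: Disjs_def)

section \<open>The adjacency formula\<close>

definition Le :: "nat \<Rightarrow> nat \<Rightarrow> (unit + nat) formula" where
  "Le x y = Rel (Inl ()) [x, y]"

definition in_block :: "nat \<Rightarrow> nat \<Rightarrow> (unit + nat) formula" where
  "in_block c x = Rel (Inr c) [x]"

text \<open>The marks are numbered consecutively: blocks, then parts, then flags in rows of length
  \<open>k + 1\<close>. Parts are counted from 1, hence \<open>i - 1\<close>.\<close>

definition in_part :: "nat \<Rightarrow> nat \<Rightarrow> nat \<Rightarrow> (unit + nat) formula" where
  "in_part k i x = Rel (Inr (num_blocks k + (i - 1))) [x]"

text \<open>Each flag is a mark that is put on all elements or on none, so it may be read off at any
  element.\<close>

definition flagged :: "nat \<Rightarrow> nat \<Rightarrow> nat \<Rightarrow> nat \<Rightarrow> (unit + nat) formula" where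
  "flagged k i j x = Rel (Inr (num_blocks k + k + i * (k + 1) + j)) [x]"

text \<open>The formula need not find the right end of \<open>x\<close> itself: any right end above
  \<open>x\<close> belongs to the same or a later vertex, and if that vertex is far below
  \<open>y\<close>, so is \<open>x\<close>.\<close>

definition diagonal_apart :: "nat \<Rightarrow> nat \<Rightarrow> (unit + nat) formula" where
  "diagonal_apart x y = Exi 2 (Conj (in_block 1 2) (Conj (Le x 2) (Le 2 y)))"

definition diagonal_adjacent :: "nat \<Rightarrow> nat \<Rightarrow> (unit + nat) formula" where
  "diagonal_adjacent k i = Conj (in_part k i 0) (Conj (in_part k i 1) (Conj (Neg (Eq 0 1))
     (Iff (flagged k i i 0) (Neg (Disj (diagonal_apart 0 1) (diagonal_apart 1 0))))))"

text \<open>The copy of the element \<open>y\<close> of part \<open>j\<close> in block \<open>c + 2\<close> is the least element of that copy of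
  part \<open>j\<close> above \<open>y\<close>; the formula says that \<open>x\<close> is below it.\<close>

definition below_copy :: "nat \<Rightarrow> nat \<Rightarrow> nat \<Rightarrow> nat \<Rightarrow> nat \<Rightarrow> (unit + nat) formula" where
  "below_copy k c j x y = Forall 2 (Disj (Neg (in_block (c + 2) 2)) (Disj (Neg (in_part k j 2))
     (Disj (Neg (Le y 2)) (Le x 2))))"

text \<open>Either vertex may come first in the order of the pair, so comparability is tested in
  both directions.\<close>

definition cross_adjacent :: "nat \<Rightarrow> nat \<Rightarrow> nat \<Rightarrow> nat \<Rightarrow> (unit + nat) formula" where
  "cross_adjacent k c x y = (case pairs k ! c of (i, j) \<Rightarrow>
     Conj (in_part k i x) (Conj (in_part k j y)
       (Iff (flagged k i j 0) (Neg (Disj (below_copy k c j x y) (below_copy k c i y x))))))"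

definition adjacent :: "nat \<Rightarrow> (unit + nat) formula" where
  "adjacent k = Disjs (map (diagonal_adjacent k) [1..<Suc k] @
     map (\<lambda>c. Disj (cross_adjacent k c 0 1) (cross_adjacent k c 1 0)) [0..<length (pairs k)])"

definition thin_transduction :: "nat \<Rightarrow> (unit, unit) transduction" where
  "thin_transduction k = \<lparr>num_marks = num_blocks k + k + (k + 1) * (k + 1),
     scheme = \<lparr>dom_formula = in_block 0 0, rel_formula = (\<lambda>_. adjacent k)\<rparr>\<rparr>"

lemma flag_index_less: "i \<le> k \<Longrightarrow> j \<le> k \<Longrightarrow> i * (k + 1) + j < (k + 1) * (k + 1)" for i j k :: nat
proof -
  assume "i \<le> k" "j \<le> k"
  then have "i * (k + 1) + j < i * (k + 1) + (k + 1)" by simp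
  also have "\<dots> = (i + 1) * (k + 1)" by simp
  also have "\<dots> \<le> (k + 1) * (k + 1)" using \<open>i \<le> k\<close> by (intro mult_le_mono1) simp
  finally show ?thesis .
qed

lemma is_transduction_thin: "is_transduction binary_signature binary_signature (thin_transduction k)"
proof -
  define \<Sigma> where "\<Sigma> = marked_signature (num_blocks k + k + (k + 1) * (k + 1)) binary_signature"
  have atoms: "formula_over \<Sigma> (Le x y)" "c < num_blocks k \<Longrightarrow> formula_over \<Sigma> (in_block c x)"
    "1 \<le> i \<Longrightarrow> i \<le> k \<Longrightarrow> formula_over \<Sigma> (in_part k i x)" for x y c i
    by (simp_all add: \<Sigma>_def Le_def in_block_def in_part_def marked_signature_def binary_signature_def)
  have fl: "formula_over \<Sigma> (flagged k i j x)" if "i \<le> k" "j \<le> k" for i j x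
    using flag_index_less[OF that] by (simp add: \<Sigma>_def flagged_def marked_signature_def)
  have vars: "free_vars (Le x y) = {x, y}" "free_vars (in_block c x) = {x}"
    "free_vars (in_part k i x) = {x}" "free_vars (flagged k i j x) = {x}" for x y c i j
    by (simp_all add: Le_def in_block_def in_part_def flagged_def)
  have blocks: "0 < num_blocks k" "1 < num_blocks k" by (simp_all add: num_blocks_def)
  have diag: "formula_over \<Sigma> (diagonal_adjacent k i) \<and> free_vars (diagonal_adjacent k i) \<subseteq> {..<2}"
    if "1 \<le> i" "i \<le> k" for i
    using that blocks by (auto simp: diagonal_adjacent_def diagonal_apart_def atoms fl vars)
  have cross: "formula_over \<Sigma> (cross_adjacent k c x y) \<and> free_vars (cross_adjacent k c x y) \<subseteq> {..<2}"
    if "c < length (pairs k)" "x < 2" "y < 2" for c x y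
  proof -
    from that(1) obtain i j where "pairs k ! c = (i, j)" "1 \<le> i" "i < j" "j \<le> k" by (rule nth_pairs)
    then show ?thesis using that
      by (auto simp: cross_adjacent_def below_copy_def atoms fl vars num_blocks_def)
  qed
  have "formula_over \<Sigma> (adjacent k)" using diag cross by (auto simp: adjacent_def)
  moreover have "free_vars (adjacent k) \<subseteq> {..<2}"
    using diag cross[of _ 0 1] cross[of _ 1 0] unfolding adjacent_def free_vars_Disjs
    by (fastforce simp: less_Suc_eq_le)
  moreover have sig: "marked_signature (num_marks (thin_transduction k)) binary_signature = \<Sigma>"
    by (simp add: thin_transduction_def \<Sigma>_def)
  ultimately show ?thesis
    using blocks unfolding is_transduction_def is_interpretation_def sig
    by (auto simp: thin_transduction_def atoms vars binary_signature_def)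
qed

section \<open>The marking and the correctness of the adjacency formula\<close>

context mixed_thin
begin

text \<open>Part marks extend over all blocks because \<open>below_copy\<close> also reads the parts
  of copies. Flag positions are decoded by quotient and remainder, and indices that are no pair get
  the empty mark.\<close>

definition marks :: "nat \<Rightarrow> (nat \<times> 'a) set" where
  "marks t =
     (if t < num_blocks k then {t} \<times> V
      else if t < num_blocks k + k then {..<num_blocks k} \<times> P (t - num_blocks k + 1)
      else let i = (t - num_blocks k - k) div (k + 1); j = (t - num_blocks k - k) mod (k + 1)
        in if 1 \<le> i \<and> i \<le> j \<and> j \<le> k \<and> flag i j then elems else {})"

lemma is_marking_marks: "is_marking (thin_transduction k) (poset_structure elems order) marks"
proof -
  have "P (t - num_blocks k + 1) \<subseteq> V" if "\<not> t < num_blocks k" "t < num_blocks k + k" for t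
    using that by (intro part_subset) auto
  then have "marks t \<subseteq> elems" for t
    unfolding marks_def Let_def elems_def by (cases "t < num_blocks k"; cases "t < num_blocks k + k") auto
  then show ?thesis by (simp add: is_marking_def poset_structure_def)
qed

text \<open>Condition (a') enters here: a part carries the same order in block 0 as in its copy in
  any block.\<close>

lemma below_imp_cross:
  assumes "1 \<le> i" "i \<le> j" "j \<le> k" "below u v" "u \<in> P i \<union> P j"
  shows "cross (i, j) u v"
proof -
  have ij: "i \<in> {1..k}" "j \<in> {1..k}" using assms by auto
  show ?thesis
  proof (cases "u \<in> P i")
    case True
    then have "v \<in> P i" "(u, v) \<in> L i i" using below_part[OF assms(4) ij(1)] by auto
    then show ?thesis using True L_restrict(1)[OF assms(1-3)] by (auto simp: cross_def)
  next
    case False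
    then have u: "u \<in> P j" using assms(5) by blast
    then have v: "v \<in> P j" "(u, v) \<in> L j j" using below_part[OF assms(4) ij(2)] by auto
    moreover have "v \<notin> P i"
      using False below_part[OF assms(4) ij(1)] by blast
    ultimately show ?thesis using False u L_restrict(2)[OF assms(1-3)] by (auto simp: cross_def)
  qed
qed

text \<open>The intermediate vertex in \<open>ord\<close> can be eliminated: \<open>u\<close> itself
  is a possible choice, and any other choice reduces to it by transitivity.\<close>

lemma ord_0_iff_cross:
  assumes p: "pairs k ! c = (i, j)" "1 \<le> i" "i < j" "j \<le> k" and u: "u \<in> P i \<union> P j"
  shows "ord 0 (c + 2) u v \<longleftrightarrow> cross (i, j) u v"
proof -
  have ij: "1 \<le> i" "i \<le> j" "j \<le> k" using p by auto
  have uV: "u \<in> V" using u ij part_subset[of i] part_subset[of j] by auto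
  have "(\<exists>w \<in> P i \<union> P j. below u w \<and> cross (i, j) w v) \<longleftrightarrow> cross (i, j) u v"
  proof
    assume "\<exists>w \<in> P i \<union> P j. below u w \<and> cross (i, j) w v"
    then obtain w where "below u w" "cross (i, j) w v" by blast
    then show "cross (i, j) u v"
      using cross_trans[OF p(2-4)] below_imp_cross[OF ij _ u] by blast
  next
    assume "cross (i, j) u v"
    then show "\<exists>w \<in> P i \<union> P j. below u w \<and> cross (i, j) w v"
      using u below_refl[OF uV] by blast
  qed
  then show ?thesis using p(1) by (simp add: ord_def base_def inside_def)
qed

text \<open>The copy of \<open>v\<close> is the least copy of \<open>P b\<close> above
  \<open>v\<close>. Taking \<open>w = v\<close> gives one direction, transitivity the other.\<close>

lemma cross_iff_copy:
  assumes p: "pairs k ! c = (i, j)" "1 \<le> i" "i < j" "j \<le> k"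
    and u: "u \<in> P i \<union> P j" and v: "v \<in> P b" "b = i \<or> b = j"
  shows "(\<forall>w \<in> P b. ord 0 (c + 2) v w \<longrightarrow> ord 0 (c + 2) u w) \<longleftrightarrow> cross (i, j) u v"
proof -
  have v': "v \<in> P i \<union> P j" using v by auto
  then have "v \<in> V" using p part_subset[of i] part_subset[of j] by auto
  then have "cross (i, j) v v" using p by (intro cross_refl) auto
  then show ?thesis
    unfolding ord_0_iff_cross[OF p u] ord_0_iff_cross[OF p v'] using v(1) cross_trans[OF p(2-4)] by blast
qed

lemma far_below_iff:
  assumes "u \<in> V" "v \<in> V"
  shows "(\<exists>w \<in> V. ord 0 1 u w \<and> ord 1 0 w v) \<longleftrightarrow> far_below u v"
proof -
  have "(\<exists>w \<in> V. below u w \<and> far_below w v) \<longleftrightarrow> far_below u v"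
    using below_refl[OF assms(1)] below_far_below assms(1) by blast
  then show ?thesis by (simp add: ord_def base_def)
qed

lemma apart_iff_far_below:
  assumes "i \<in> {1..k}" "u \<in> P i" "v \<in> P i" "u \<noteq> v"
  shows "apart i i u v \<longleftrightarrow> far_below u v \<or> far_below v u"
proof -
  have iff: "far_below x y \<longleftrightarrow> (x, y) \<in> L i i \<and> apart i i x y" if "x \<in> P i" "y \<in> P i" "x \<noteq> y" for x y
  proof
    assume "far_below x y"
    then obtain l where l: "l \<in> {1..k}" "x \<in> P l" "(x, y) \<in> L l l" "apart l l x y"
      by (auto simp: far_below_def)
    then have "l = i" using part_eq[of x l i] that(1) assms(1) by blast
    with l show "(x, y) \<in> L i i \<and> apart i i x y" by simp
  qed (use assms(1) that in \<open>auto simp: far_below_def\<close>)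
  have "(u, v) \<in> L i i \<or> (v, u) \<in> L i i" using L_total[of i i u v] assms by simp
  then show ?thesis using iff[of u v] iff[of v u] assms apart_commute[of i i u v] by blast
qed

lemma apart_iff_cross:
  assumes "1 \<le> i" "i < j" "j \<le> k" "u \<in> P i" "v \<in> P j"
  shows "apart i j u v \<longleftrightarrow> cross (i, j) u v \<or> cross (i, j) v u"
proof -
  have "u \<notin> P j" "v \<notin> P i" using part_eq[of _ i j] assms by auto
  then show ?thesis
    using L_total[of i j u v] apart_commute[of i j u v] assms by (auto simp: cross_def)
qed

abbreviation marked :: "(unit + nat, nat \<times> 'a) rel_structure" where
  "marked \<equiv> mark_structure (num_marks (thin_transduction k)) marks (poset_structure elems order)"

lemma universe_marked: "universe marked = elems"
  by (simp add: mark_structure_def poset_structure_def)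

lemma sat_Le: "sat marked e (Le x y) \<longleftrightarrow> (e x, e y) \<in> order"
  using order_subset by (cases "e x"; cases "e y") (auto simp: Le_def mark_structure_def poset_structure_def)

lemma sat_mark: "t < num_marks (thin_transduction k) \<Longrightarrow> sat marked e (Rel (Inr t) [x]) \<longleftrightarrow> e x \<in> marks t"
  by (cases "e x") (simp add: mark_structure_def)

lemma sat_in_block: "c < num_blocks k \<Longrightarrow> sat marked e (in_block c x) \<longleftrightarrow> e x \<in> {c} \<times> V"
  unfolding in_block_def by (subst sat_mark) (simp_all add: thin_transduction_def marks_def)

lemma sat_in_part: "i \<in> {1..k} \<Longrightarrow> sat marked e (in_part k i x) \<longleftrightarrow> e x \<in> {..<num_blocks k} \<times> P i"
  unfolding in_part_def by (subst sat_mark) (auto simp: thin_transduction_def marks_def)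

lemma sat_flagged:
  assumes "1 \<le> i" "i \<le> j" "j \<le> k" "e x \<in> elems"
  shows "sat marked e (flagged k i j x) \<longleftrightarrow> flag i j"
proof -
  let ?t = "num_blocks k + k + i * (k + 1) + j"
  have t: "?t - num_blocks k - k = j + i * (k + 1)" by simp
  have "(j + i * (k + 1)) div (k + 1) = i" "(j + i * (k + 1)) mod (k + 1) = j"
    using assms(3) by (simp_all only: div_mult_self1 mod_mult_self1) simp_all
  then have "marks ?t = (if flag i j then elems else {})"
    unfolding marks_def t Let_def using assms(1-3) by simp
  moreover have "?t < num_marks (thin_transduction k)"
    using flag_index_less[of i k j] assms(1-3) by (simp add: thin_transduction_def)
  ultimately show ?thesis
    unfolding flagged_def using sat_mark[of ?t e x] assms(4) by simp
qed

text \<open>Variable 2 is bound by the formula, so \<open>x\<close> and \<open>y\<close> have to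
  differ from it.\<close>

lemma sat_diagonal_apart:
  assumes "e x = (0, u)" "e y = (0, v)" "u \<in> V" "v \<in> V" "x \<noteq> 2" "y \<noteq> 2"
  shows "sat marked e (diagonal_apart x y) \<longleftrightarrow> far_below u v"
proof -
  have b: "1 < num_blocks k" "0 < num_blocks k" by (simp_all add: num_blocks_def)
  have "sat marked e (diagonal_apart x y) \<longleftrightarrow>
      (\<exists>z \<in> elems. z \<in> {1} \<times> V \<and> ((0, u), z) \<in> order \<and> (z, (0, v)) \<in> order)"
    using assms b by (simp add: diagonal_apart_def universe_marked sat_in_block sat_Le)
  also have "\<dots> \<longleftrightarrow> (\<exists>w \<in> V. ord 0 1 u w \<and> ord 1 0 w v)"
    using b assms(3,4) by (auto simp: order_def elems_def)
  finally show ?thesis using far_below_iff[OF assms(3,4)] by simp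
qed

lemma sat_below_copy:
  assumes "e x = (0, u)" "e y = (0, v)" "x \<noteq> 2" "y \<noteq> 2"
    and c: "c < length (pairs k)" and p: "pairs k ! c = (i, j)" "1 \<le> i" "i < j" "j \<le> k"
    and u: "u \<in> P i \<union> P j" and v: "v \<in> P b" "b = i \<or> b = j"
  shows "sat marked e (below_copy k c b x y) \<longleftrightarrow> cross (i, j) u v"
proof -
  have b: "c + 2 < num_blocks k" "0 < num_blocks k" "b \<in> {1..k}" using c p v by (auto simp: num_blocks_def)
  have V: "P b \<subseteq> V" "u \<in> V" "v \<in> V"
    using b(3) p u v part_subset[of i] part_subset[of j] by auto
  have "sat marked e (below_copy k c b x y) \<longleftrightarrow>
      (\<forall>z \<in> elems. ((0, v), z) \<in> order \<longrightarrow> z \<in> {..<num_blocks k} \<times> P b \<longrightarrow> z \<in> {c + 2} \<times> V \<longrightarrow> ((0, u), z) \<in> order)"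
    unfolding below_copy_def sat_connectives universe_marked sat.simps sat_in_block[OF b(1)]
      sat_in_part[OF b(3)] sat_Le using assms(1-4) by simp
  also have "\<dots> \<longleftrightarrow> (\<forall>w \<in> P b. ((0, v), (c + 2, w)) \<in> order \<longrightarrow> ((0, u), (c + 2, w)) \<in> order)"
    using b(1) V(1) unfolding elems_def by blast
  also have "\<dots> \<longleftrightarrow> (\<forall>w \<in> P b. ord 0 (c + 2) v w \<longrightarrow> ord 0 (c + 2) u w)"
  proof (intro ball_cong refl)
    fix w assume "w \<in> P b"
    then have "((0, x), (c + 2, w)) \<in> order \<longleftrightarrow> ord 0 (c + 2) x w" if "x \<in> V" for x
      using b(1,2) V(1) that unfolding order_def elems_def by blast
    then show "(((0, v), (c + 2, w)) \<in> order \<longrightarrow> ((0, u), (c + 2, w)) \<in> order)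
        \<longleftrightarrow> (ord 0 (c + 2) v w \<longrightarrow> ord 0 (c + 2) u w)"
      using V(2,3) by metis
  qed
  finally show ?thesis using cross_iff_copy[OF p u v] by simp
qed

lemma edge_in: "{u, v} \<in> E \<Longrightarrow> u \<in> V \<and> v \<in> V \<and> u \<noteq> v"
proof -
  assume "{u, v} \<in> E"
  then have "{u, v} \<subseteq> V" "card {u, v} = 2" using graph by (auto simp: simple_graph_def nsets_def)
  then show ?thesis by (cases "u = v") auto
qed

lemma sat_diagonal_adjacent:
  assumes "e 0 = (0, u)" "e 1 = (0, v)" "u \<in> V" "v \<in> V" "i \<in> {1..k}"
  shows "sat marked e (diagonal_adjacent k i) \<longleftrightarrow> u \<in> P i \<and> v \<in> P i \<and> {u, v} \<in> E"
proof -
  have b: "0 < num_blocks k" by (simp add: num_blocks_def)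
  have fl: "sat marked e (flagged k i i 0) \<longleftrightarrow> flag i i"
    using assms b by (intro sat_flagged) (auto simp: elems_def)
  have "sat marked e (diagonal_adjacent k i) \<longleftrightarrow>
      u \<in> P i \<and> v \<in> P i \<and> u \<noteq> v \<and> (flag i i \<longleftrightarrow> \<not> (far_below u v \<or> far_below v u))"
    using assms b fl sat_diagonal_apart[OF assms(1-4)] sat_diagonal_apart[OF assms(2,1,4,3)]
    by (simp add: diagonal_adjacent_def sat_in_part)
  \<comment> \<open>\<open>apart\<close> is the exclusive or of adjacency and flag, so comparing it
    with the flag once more gives adjacency back.\<close>
  also have "\<dots> \<longleftrightarrow> u \<in> P i \<and> v \<in> P i \<and> {u, v} \<in> E"
    using apart_iff_far_below[OF assms(5), of u v] edge_in[of u v] unfolding apart_def by blast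
  finally show ?thesis .
qed

lemma sat_cross_adjacent:
  assumes "e x = (0, u)" "e y = (0, v)" "x \<noteq> 2" "y \<noteq> 2" "u \<in> V" "v \<in> V" "e 0 \<in> elems"
    and c: "c < length (pairs k)" and p: "pairs k ! c = (i, j)" "1 \<le> i" "i < j" "j \<le> k"
  shows "sat marked e (cross_adjacent k c x y) \<longleftrightarrow> u \<in> P i \<and> v \<in> P j \<and> {u, v} \<in> E"
proof (cases "u \<in> P i \<and> v \<in> P j")
  case True
  have b: "0 < num_blocks k" by (simp add: num_blocks_def)
  have fl: "sat marked e (flagged k i j 0) \<longleftrightarrow> flag i j"
    using assms(7) p by (intro sat_flagged) auto
  have "sat marked e (below_copy k c j x y) \<longleftrightarrow> cross (i, j) u v"
    "sat marked e (below_copy k c i y x) \<longleftrightarrow> cross (i, j) v u"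
    using True by (intro sat_below_copy[OF _ _ _ _ c p] assms(1-4); simp)+
  with fl show ?thesis
    using True assms(1,2) b p apart_iff_cross[OF p(2-4), of u v]
    by (auto simp: cross_adjacent_def sat_in_part apart_def)
next
  case False
  then show ?thesis using assms(1,2) p by (auto simp: cross_adjacent_def sat_in_part)
qed

lemma sat_adjacent_iff:
  "sat \<AA> e (adjacent k) \<longleftrightarrow> (\<exists>i \<in> {1..k}. sat \<AA> e (diagonal_adjacent k i)) \<or>
     (\<exists>c < length (pairs k). sat \<AA> e (cross_adjacent k c 0 1) \<or> sat \<AA> e (cross_adjacent k c 1 0))"
proof -
  have "set [1..<Suc k] = {1..k}" "set [0..<length (pairs k)] = {..<length (pairs k)}" by auto
  then show ?thesis unfolding adjacent_def sat_Disjs set_append set_map bex_Un by (auto simp: Bex_def)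
qed

lemma sat_adjacent:
  assumes e: "e 0 = (0, u)" "e 1 = (0, v)" and uv: "u \<in> V" "v \<in> V"
  shows "sat marked e (adjacent k) \<longleftrightarrow> {u, v} \<in> E"
proof
  have b: "e 0 \<in> elems" using e uv by (simp add: elems_def num_blocks_def)
  have ne: "(0::nat) \<noteq> 2" "(1::nat) \<noteq> 2" by simp_all
  assume "sat marked e (adjacent k)"
  then consider i where "i \<in> {1..k}" "sat marked e (diagonal_adjacent k i)"
    | c where "c < length (pairs k)" "sat marked e (cross_adjacent k c 0 1) \<or> sat marked e (cross_adjacent k c 1 0)"
    unfolding sat_adjacent_iff by blast
  then show "{u, v} \<in> E"
  proof cases
    case 1
    then show ?thesis using sat_diagonal_adjacent[OF e uv] by blast
  next
    case 2
    obtain i j where p: "pairs k ! c = (i, j)" "1 \<le> i" "i < j" "j \<le> k" using 2(1) by (rule nth_pairs)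
    show ?thesis
      using 2(2) sat_cross_adjacent[OF e ne uv b 2(1) p] sat_cross_adjacent[OF e(2,1) ne(2,1) uv(2,1) b 2(1) p]
      by (auto simp: insert_commute)
  qed
next
  have b: "e 0 \<in> elems" using e uv by (simp add: elems_def num_blocks_def)
  have ne: "(0::nat) \<noteq> 2" "(1::nat) \<noteq> 2" by simp_all
  assume uvE: "{u, v} \<in> E"
  obtain i j where ij: "i \<in> {1..k}" "u \<in> P i" "j \<in> {1..k}" "v \<in> P j"
    using uv by (meson obtain_part)
  have pair: "\<exists>c < length (pairs k). pairs k ! c = (a, b)" if "1 \<le> a" "a < b" "b \<le> k" for a b
    using that by (simp add: in_set_conv_nth[symmetric] set_pairs)
  consider "i = j" | "i < j" | "j < i" by linarith
  then show "sat marked e (adjacent k)"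
  proof cases
    case 1
    then have "sat marked e (diagonal_adjacent k i)" using sat_diagonal_adjacent[OF e uv ij(1)] uvE ij by blast
    then show ?thesis unfolding sat_adjacent_iff using ij(1) by blast
  next
    case 2
    then obtain c where c: "c < length (pairs k)" "pairs k ! c = (i, j)" using pair[of i j] ij by auto
    then have "sat marked e (cross_adjacent k c 0 1)"
      using sat_cross_adjacent[OF e ne uv b c] 2 ij uvE by auto
    then show ?thesis unfolding sat_adjacent_iff using c(1) by blast
  next
    case 3
    then obtain c where c: "c < length (pairs k)" "pairs k ! c = (j, i)" using pair[of j i] ij by auto
    then have "sat marked e (cross_adjacent k c 1 0)"
      using sat_cross_adjacent[OF e(2,1) ne(2,1) uv(2,1) b c] 3 ij uvE by (auto simp: insert_commute)
    then show ?thesis unfolding sat_adjacent_iff using c(1) by blast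
  qed
qed

text \<open>On pairs the output is \<open>G\<close> only up to the renaming \<open>Pair 0\<close>;
  the equality with \<open>G\<close> is reached after moving the poset.\<close>

theorem transduce_marked_thin:
  "transduce_marked binary_signature (thin_transduction k) (poset_structure elems order) marks
     = map_structure (Pair 0) (graph_structure V E)"
proof -
  let ?I = "scheme (thin_transduction k)"
  have U: "interpreted_universe ?I marked = Pair 0 ` V"
    using sat_in_block[of 0] unfolding interpreted_universe_def universe_marked
    by (auto simp: thin_transduction_def num_blocks_def elems_def)
  have "{xs. set xs \<subseteq> Pair 0 ` V \<and> binary_signature r = Some (length xs) \<and>
      sat marked (\<lambda>i. xs ! i) (rel_formula ?I r)}
      = map (Pair 0) ` {[u, v] |u v. u \<in> V \<and> v \<in> V \<and> {u, v} \<in> E}" (is "?X = ?Y") for r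
  proof (intro equalityI subsetI)
    fix xs assume xs: "xs \<in> ?X"
    then have "length xs = 2" by (simp add: binary_signature_def)
    then obtain a b where "xs = [a, b]" by (auto simp: length_Suc_conv numeral_2_eq_2)
    with xs obtain u v where uv: "xs = [(0, u), (0, v)]" "u \<in> V" "v \<in> V" by auto
    then have "{u, v} \<in> E"
      using xs sat_adjacent[of "\<lambda>i. xs ! i" u v] by (simp add: thin_transduction_def)
    then show "xs \<in> ?Y" using uv by (intro image_eqI[of _ _ "[u, v]"]) auto
  next
    fix xs assume "xs \<in> ?Y"
    then obtain u v where uv: "xs = [(0, u), (0, v)]" "u \<in> V" "v \<in> V" "{u, v} \<in> E" by auto
    then show "xs \<in> ?X"
      using sat_adjacent[of "\<lambda>i. xs ! i" u v] by (simp add: thin_transduction_def binary_signature_def)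
  qed
  then show ?thesis
    unfolding transduce_marked_def apply_scheme_def U by (simp add: map_structure_def graph_structure_def)
qed

end

section \<open>Moving the poset to a given set of elements\<close>

context mixed_thin
begin

text \<open>An arbitrary \<open>h\<close> serves both claims: an injection into an infinite type for
  the inclusion of classes, and the numbering of the pairs for the algorithm. The condition on
  \<open>h (0, v)\<close> makes the output equal to \<open>G\<close> and not merely
  isomorphic.\<close>

theorem image_poset:
  fixes h :: "nat \<times> 'a \<Rightarrow> 'a"
  assumes h: "inj_on h elems" and h0: "\<forall>v \<in> V. h (0, v) = v"
  defines "A \<equiv> h ` elems" and "r \<equiv> map_prod h h ` order" and "M \<equiv> \<lambda>t. h ` marks t"
  shows "finite_poset A r" and "poset_width A r \<le> 5 * (k choose 2) + 2 * k"
    and "is_marking (thin_transduction k) (poset_structure A r) M"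
    and "transduce_marked binary_signature (thin_transduction k) (poset_structure A r) M = graph_structure V E"
proof -
  let ?P = "poset_structure elems order" and ?T = "thin_transduction k"
  have P: "poset_structure A r = map_structure h ?P"
    unfolding A_def r_def by (rule map_structure_poset[OF order_subset, symmetric])
  have U: "universe ?P = elems" by (simp add: poset_structure_def)
  show fin: "finite_poset A r"
    unfolding A_def r_def by (rule finite_poset_image[OF finite_poset order_subset h])
  show "poset_width A r \<le> 5 * (k choose 2) + 2 * k"
  proof (rule poset_width_le)
    show "finite A" using fin by (simp add: finite_poset_def)
    fix X assume "antichain_in A r X"
    then obtain Y where Y: "antichain_in elems order Y" "X = h ` Y"
      unfolding A_def r_def by (rule antichain_in_image)
    then have "finite Y" using finite_subset[of Y elems] finite_V by (auto simp: antichain_in_def elems_def)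
    then have "card X \<le> card Y" unfolding Y(2) by (rule card_image_le)
    then show "card X \<le> 5 * (k choose 2) + 2 * k" using card_antichain[OF Y(1)] by simp
  qed
  show "is_marking ?T (poset_structure A r) M"
    using is_marking_marks unfolding is_marking_def A_def M_def by (auto simp: poset_structure_def)
  have "transduce_marked binary_signature ?T (poset_structure A r) M
      = map_structure h (map_structure (Pair 0) (graph_structure V E))"
    unfolding P M_def
    using transduce_marked_image[OF is_transduction_thin structure_over_poset_structure is_marking_marks, of h] h
    by (simp add: U transduce_marked_thin)
  also have "\<dots> = graph_structure V E"
    unfolding map_structure_comp
    by (rule map_structure_ident[OF structure_over_graph_structure]) (simp add: graph_structure_def h0)
  finally show "transduce_marked binary_signature ?T (poset_structure A r) M = graph_structure V E" .
qed

end

lemma infinite_extension: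
  fixes V :: "'a :: infinite set"
  assumes "finite V"
  shows "\<exists>h :: nat \<times> 'a \<Rightarrow> 'a. inj_on h ({..<b} \<times> V) \<and> (\<forall>v \<in> V. h (0, v) = v)"
proof -
  have "infinite (UNIV - V)" using assms infinite_UNIV by (rule Diff_infinite_finite)
  \<comment> \<open>There is a fresh element for every pair, although the pairs of block 0 keep
    their vertex as image; this avoids a separate count.\<close>
  then obtain S where S: "S \<subseteq> UNIV - V" "finite S" "card S = card ({..<b} \<times> V)"
    using infinite_arbitrarily_large by blast
  then obtain g where g: "bij_betw g ({..<b} \<times> V) S"
    using finite_same_card_bij[of "{..<b} \<times> V" S] assms by auto
  define h where "h x = (if fst x = 0 then snd x else g x)" for x
  have gV: "g x \<notin> V" if "x \<in> {..<b} \<times> V" for x using bij_betwE[OF g] that S(1) by blast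
  have "inj_on h ({..<b} \<times> V)"
  proof (rule inj_onI)
    fix x y assume xy: "x \<in> {..<b} \<times> V" "y \<in> {..<b} \<times> V" "h x = h y"
    show "x = y"
    proof (cases "fst x = 0"; cases "fst y = 0")
      assume "fst x \<noteq> 0" "fst y \<noteq> 0"
      then have "g x = g y" using xy(3) by (simp add: h_def)
      then show ?thesis using bij_betw_imp_inj_on[OF g] xy(1,2) by (meson inj_onD)
    next
      assume "fst x = 0" "fst y = 0"
      then show ?thesis using xy(3) by (simp add: h_def prod_eq_iff)
    next
      assume "fst x = 0" "fst y \<noteq> 0"
      then have "snd x = g y" using xy(3) by (simp add: h_def)
      then show ?thesis using gV[OF xy(2)] xy(1) by auto
    next
      assume "fst x \<noteq> 0" "fst y = 0"
      then have "g x = snd y" using xy(3) by (simp add: h_def)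
      then show ?thesis using gV[OF xy(1)] xy(2) by auto
    qed
  qed
  moreover have "\<forall>v \<in> V. h (0, v) = v" by (simp add: h_def)
  ultimately show ?thesis by blast
qed

theorem mixed_thin_graphs_transduction:
  "(mixed_thin_graphs k :: (unit, 'a :: infinite) rel_structure set)
     \<subseteq> transduce_class binary_signature (thin_transduction k)
         (posets_of_width_at_most (5 * (k choose 2) + 2 * k))"
proof
  fix \<AA> :: "(unit, 'a) rel_structure" assume "\<AA> \<in> mixed_thin_graphs k"
  then obtain V E P L where VE: "\<AA> = graph_structure V E" "simple_graph V E" "mixed_thin_witness k V E P L"
    unfolding mixed_thin_graphs_def inversion_free_proper_mixed_thin_def by blast
  \<comment> \<open>The vertices outside of a pair only have to form a chain, so any linear order on
    \<open>V\<close> will do.\<close>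
  obtain W where "well_order_on V W" using well_order_on by blast
  then interpret mixed_thin k V E P L W
    using VE(2,3) by unfold_locales (simp_all add: well_order_on_def)
  obtain h where h: "inj_on h elems" "\<forall>v \<in> V. h (0, v) = v"
    using infinite_extension[OF finite_V, of "num_blocks k"] unfolding elems_def by blast
  note image = image_poset[OF h]
  let ?Q = "poset_structure (h ` elems) (map_prod h h ` order)"
  have "?Q \<in> posets_of_width_at_most (5 * (k choose 2) + 2 * k)"
    unfolding posets_of_width_at_most_def using image(1,2) by blast
  moreover have "\<AA> \<in> transduce binary_signature (thin_transduction k) ?Q"
    unfolding transduce_def VE(1) image(4)[symmetric] using image(3) by blast
  ultimately show "\<AA> \<in> transduce_class binary_signature (thin_transduction k)
      (posets_of_width_at_most (5 * (k choose 2) + 2 * k))"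
    unfolding transduce_class_def by blast
qed

section \<open>Reading and writing the encodings\<close>

lemma mult_add_less: "u < c \<Longrightarrow> v < n \<Longrightarrow> u * n + v < c * n" for u v c n :: nat
proof -
  assume "u < c" "v < n"
  then have "u * n + v < (u + 1) * n" by simp
  also have "\<dots> \<le> c * n" using \<open>u < c\<close> by (intro mult_le_mono1) simp
  finally show ?thesis .
qed

lemma length_concat_map:
  "(\<And>x. x \<in> set xs \<Longrightarrow> length (f x) = l) \<Longrightarrow> length (concat (map f xs)) = length xs * l"
  by (induction xs) auto

lemma nth_concat_map:
  "(\<And>x. x \<in> set xs \<Longrightarrow> length (f x) = l) \<Longrightarrow> c < length xs \<Longrightarrow> t < l \<Longrightarrow>
     concat (map f xs) ! (c * l + t) = f (xs ! c) ! t"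
proof (induction xs arbitrary: c)
  case (Cons x xs)
  show ?case
  proof (cases c)
    case 0
    then show ?thesis using Cons.prems by (simp add: nth_append)
  next
    case (Suc d)
    then have "concat (map f xs) ! (d * l + t) = f (xs ! d) ! t"
      using Cons.prems by (intro Cons.IH) auto
    then show ?thesis using Cons.prems Suc by (simp add: nth_append)
  qed
qed simp

lemma concat_map_concat: "concat (map f (concat xss)) = concat (map (\<lambda>xs. concat (map f xs)) xss)"
  by (induction xss) simp_all

lemma length_relation_bits [simp]: "length (relation_bits n R) = n * n"
  unfolding relation_bits_def by (subst length_concat_map[where l = n]) simp_all

lemma nth_relation_bits: "u < n \<Longrightarrow> v < n \<Longrightarrow> relation_bits n R ! (u * n + v) = of_bool (R u v)"
  unfolding relation_bits_def by (subst nth_concat_map[where l = n]) simp_all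

lemma length_set_bits [simp]: "length (set_bits n A) = n"
  by (simp add: set_bits_def)

lemma nth_set_bits: "u < n \<Longrightarrow> set_bits n A ! u = of_bool (u \<in> A)"
  by (simp add: set_bits_def)

definition all_pairs :: "nat \<Rightarrow> (nat \<times> nat) list" where
  "all_pairs k = concat (map (\<lambda>i. map (Pair i) [i..<Suc k]) [1..<Suc k])"

text \<open>Since \<open>k\<close> is fixed, this position enters the program as a constant, so an
  unspecified choice is as good as an explicit formula.\<close>

definition pair_index :: "nat \<Rightarrow> nat \<Rightarrow> nat \<Rightarrow> nat" where
  "pair_index k i j = (SOME c. c < length (all_pairs k) \<and> all_pairs k ! c = (i, j))"

lemma pair_index:
  assumes "1 \<le> i" "i \<le> j" "j \<le> k"
  shows "pair_index k i j < length (all_pairs k)" "all_pairs k ! pair_index k i j = (i, j)"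
proof -
  have "(i, j) \<in> set (all_pairs k)" using assms by (auto simp: all_pairs_def simp del: upt_Suc intro!: bexI[of _ i])
  then have "\<exists>c. c < length (all_pairs k) \<and> all_pairs k ! c = (i, j)" by (simp add: in_set_conv_nth)
  from someI_ex[OF this] show "pair_index k i j < length (all_pairs k)" "all_pairs k ! pair_index k i j = (i, j)"
    by (simp_all add: pair_index_def)
qed

text \<open>Flattening the nested lists of orders leaves blocks of equal length, which can be
  addressed by multiplication.\<close>

lemma encode_instance_eq:
  "encode_instance k n E P L = n # relation_bits n (\<lambda>u v. {u, v} \<in> E) @
     concat (map (\<lambda>i. set_bits n (P i)) [1..<Suc k]) @
     concat (map (\<lambda>(i, j). relation_bits n (\<lambda>u v. (u, v) \<in> L i j)) (all_pairs k))"
  unfolding encode_instance_def all_pairs_def concat_map_concat by (simp add: o_def del: upt_Suc)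

lemma encode_instance_parts:
  fixes k n :: nat and E P L
  defines "xs \<equiv> encode_instance k n E P L"
  shows length_encode_instance: "length xs = 1 + n * n + k * n + length (all_pairs k) * (n * n)"
    and nth_encode_size: "xs ! 0 = n"
    and nth_encode_edge: "u < n \<Longrightarrow> v < n \<Longrightarrow> xs ! (1 + u * n + v) = of_bool ({u, v} \<in> E)"
    and nth_encode_part: "i \<in> {1..k} \<Longrightarrow> u < n \<Longrightarrow> xs ! (1 + n * n + (i - 1) * n + u) = of_bool (u \<in> P i)"
    and nth_encode_order: "1 \<le> i \<Longrightarrow> i \<le> j \<Longrightarrow> j \<le> k \<Longrightarrow> u < n \<Longrightarrow> v < n \<Longrightarrow>
      xs ! (1 + n * n + k * n + pair_index k i j * (n * n) + u * n + v) = of_bool ((u, v) \<in> L i j)"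
proof -
  let ?e = "relation_bits n (\<lambda>u v. {u, v} \<in> E)"
  let ?p = "concat (map (\<lambda>i. set_bits n (P i)) [1..<Suc k])"
  let ?l = "concat (map (\<lambda>(i, j). relation_bits n (\<lambda>u v. (u, v) \<in> L i j)) (all_pairs k))"
  have xs: "xs = n # ?e @ ?p @ ?l" unfolding xs_def by (rule encode_instance_eq)
  have lp: "length ?p = k * n"
    by (subst length_concat_map[where l = n]) (simp_all del: upt_Suc)
  have ll: "length ?l = length (all_pairs k) * (n * n)"
    by (rule length_concat_map) auto
  show "length xs = 1 + n * n + k * n + length (all_pairs k) * (n * n)"
    unfolding xs by (simp only: length_append list.size lp ll length_relation_bits)
  show "xs ! 0 = n" by (simp add: xs)
  show "xs ! (1 + u * n + v) = of_bool ({u, v} \<in> E)" if "u < n" "v < n"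
    using nth_relation_bits[OF that] mult_add_less[OF that] by (simp add: xs nth_append)
  show "xs ! (1 + n * n + (i - 1) * n + u) = of_bool (u \<in> P i)" if "i \<in> {1..k}" "u < n"
  proof -
    have "?p ! ((i - 1) * n + u) = set_bits n (P ([1..<Suc k] ! (i - 1))) ! u"
      using that by (intro nth_concat_map) (auto simp del: upt_Suc)
    also have "\<dots> = of_bool (u \<in> P i)"
      using that by (auto simp: nth_set_bits simp del: upt_Suc)
    finally have "?p ! ((i - 1) * n + u) = of_bool (u \<in> P i)" .
    moreover have "(i - 1) * n + u < k * n" using that by (intro mult_add_less) auto
    moreover have "1 + n * n + (i - 1) * n + u = Suc (length ?e + ((i - 1) * n + u))" by simp
    ultimately show ?thesis unfolding xs by (simp only: nth_Cons_Suc nth_append_length_plus) (simp only: nth_append lp if_True)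
  qed
  show "xs ! (1 + n * n + k * n + pair_index k i j * (n * n) + u * n + v) = of_bool ((u, v) \<in> L i j)"
    if "1 \<le> i" "i \<le> j" "j \<le> k" "u < n" "v < n"
  proof -
    have "?l ! (pair_index k i j * (n * n) + (u * n + v)) =
        (case all_pairs k ! pair_index k i j of (i, j) \<Rightarrow> relation_bits n (\<lambda>u v. (u, v) \<in> L i j)) ! (u * n + v)"
      using pair_index(1)[OF that(1-3)] mult_add_less[OF that(4,5)] by (intro nth_concat_map) auto
    also have "\<dots> = of_bool ((u, v) \<in> L i j)"
      using that by (simp add: pair_index nth_relation_bits)
    finally have *: "?l ! (pair_index k i j * (n * n) + (u * n + v)) = of_bool ((u, v) \<in> L i j)" .
    have "1 + n * n + k * n + pair_index k i j * (n * n) + u * n + v =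
        Suc (length ?e + (length ?p + (pair_index k i j * (n * n) + (u * n + v))))"
      unfolding lp by simp
    then show ?thesis unfolding xs by (simp only: nth_Cons_Suc nth_append_length_plus *)
  qed
qed

text \<open>All entries but the first are bits, and the first is at most the number
  \<open>n * n\<close> of adjacency bits.\<close>

lemma encode_instance_entries:
  assumes "y \<in> set (encode_instance k n E P L)"
  shows "y \<le> length (encode_instance k n E P L)"
proof -
  have bits: "y \<le> 1" if "y \<in> set (relation_bits n R)" for R
    using that by (auto simp: relation_bits_def)
  have "y \<le> 1" if "y \<in> set (set_bits n A)" for A
    using that by (auto simp: set_bits_def)
  with bits assms have "y = n \<or> y \<le> 1" unfolding encode_instance_def by auto
  moreover have "n \<le> n * n" by simp
  ultimately show ?thesis unfolding length_encode_instance by linarith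
qed

lemma length_encode_marked_poset: "length (encode_marked_poset q m r M) = 1 + m * m + q * m"
  unfolding encode_marked_poset_def by (simp add: length_concat_map[where l = m])

text \<open>Bounded existential statements replace quotient and remainder here because terms have
  bounded sums but no division.\<close>

lemma nth_encode_marked_poset:
  assumes "x < 1 + m * m + q * m"
  shows "encode_marked_poset q m r M ! x = (if x = 0 then m else
     of_bool ((\<exists>a<m. \<exists>b<m. x = 1 + a * m + b \<and> (a, b) \<in> r) \<or>
              (\<exists>t<q. \<exists>a<m. x = 1 + m * m + t * m + a \<and> a \<in> M t)))"
proof (cases "x = 0")
  case False
  let ?e = "relation_bits m (\<lambda>a b. (a, b) \<in> r)"
  let ?p = "concat (map (\<lambda>i. set_bits m (M i)) [0..<q])"
  have xs: "encode_marked_poset q m r M = m # ?e @ ?p" by (simp add: encode_marked_poset_def)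
  have e: "encode_marked_poset q m r M ! (1 + a * m + b) = of_bool ((a, b) \<in> r)" if "a < m" "b < m" for a b
    using nth_relation_bits[OF that] mult_add_less[OF that] by (simp add: xs nth_append)
  have p: "encode_marked_poset q m r M ! (1 + m * m + t * m + a) = of_bool (a \<in> M t)" if "t < q" "a < m" for t a
  proof -
    have "?p ! (t * m + a) = set_bits m (M ([0..<q] ! t)) ! a"
      using that by (intro nth_concat_map) auto
    then have *: "?p ! (t * m + a) = of_bool (a \<in> M t)" using that by (simp add: nth_set_bits)
    have "1 + m * m + t * m + a = Suc (length ?e + (t * m + a))" by simp
    then show ?thesis unfolding xs by (simp only: nth_Cons_Suc nth_append_length_plus *)
  qed
  have m: "0 < m" using assms False by (cases "m = 0") auto
  have cases: "(\<exists>a<m. \<exists>b<m. x = 1 + a * m + b) \<or> (\<exists>t<q. \<exists>a<m. x = 1 + m * m + t * m + a)"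
  proof (cases "x - 1 < m * m")
    case True
    then have "(x - 1) div m < m" using m by (simp add: less_mult_imp_div_less)
    moreover have "x = 1 + (x - 1) div m * m + (x - 1) mod m" using False by simp
    ultimately show ?thesis using m mod_less_divisor by blast
  next
    case F: False
    let ?y = "x - 1 - m * m"
    have "?y < q * m" using assms F False by linarith
    then have "?y div m < q" by (simp add: less_mult_imp_div_less)
    moreover have "?y = ?y div m * m + ?y mod m" by simp
    then have "x = 1 + m * m + ?y div m * m + ?y mod m" using F False by linarith
    ultimately show ?thesis using m mod_less_divisor by blast
  qed
  have "encode_marked_poset q m r M ! x = of_bool
      ((\<exists>a<m. \<exists>b<m. x = 1 + a * m + b \<and> (a, b) \<in> r) \<or> (\<exists>t<q. \<exists>a<m. x = 1 + m * m + t * m + a \<and> a \<in> M t))"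
    (is "_ = of_bool ?R")
  proof (cases ?R)
    case True
    then have "encode_marked_poset q m r M ! x = 1"
    proof (elim disjE exE conjE)
      fix a b assume "a < m" "b < m" "x = 1 + a * m + b" "(a, b) \<in> r"
      then show ?thesis using e[of a b] by simp
    next
      fix t a assume "t < q" "a < m" "x = 1 + m * m + t * m + a" "a \<in> M t"
      then show ?thesis using p[of t a] by simp
    qed
    then show ?thesis using True by simp
  next
    case F: False
    from cases have "encode_marked_poset q m r M ! x = 0"
    proof (elim disjE exE conjE)
      fix a b assume "a < m" "b < m" "x = 1 + a * m + b"
      then show ?thesis using F e[of a b] by auto
    next
      fix t a assume "t < q" "a < m" "x = 1 + m * m + t * m + a"
      then show ?thesis using F p[of t a] by auto
    qed
    then show ?thesis using F by simp
  qed
  then show ?thesis using False by simp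
qed (simp add: encode_marked_poset_def)

section \<open>Computing the poset\<close>

text \<open>Any nonzero value counts as true. Then addition is disjunction, multiplication is
  conjunction, and a sum is a bounded existential quantifier; double negation normalises a value to
  a bit.\<close>

definition holds :: "tm \<Rightarrow> nat list \<Rightarrow> (nat \<Rightarrow> nat) \<Rightarrow> bool" where
  "holds t xs e \<longleftrightarrow> teval t xs e \<noteq> 0"

definition tNot :: "tm \<Rightarrow> tm" where
  "tNot t = TSub (TC 1) t"

definition tEq :: "tm \<Rightarrow> tm \<Rightarrow> tm" where
  "tEq s t = tNot (TAdd (TSub s t) (TSub t s))"

definition tLe :: "tm \<Rightarrow> tm \<Rightarrow> tm" where
  "tLe s t = tNot (TSub s t)"

definition tXor :: "tm \<Rightarrow> tm \<Rightarrow> tm" where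
  "tXor s t = TAdd (TMul s (tNot t)) (TMul (tNot s) t)"

definition tOrs :: "tm list \<Rightarrow> tm" where
  "tOrs ts = foldr TAdd ts (TC 0)"

lemma holds_simps [simp]:
  "holds (TC c) xs e \<longleftrightarrow> c \<noteq> 0"
  "holds (TAdd s t) xs e \<longleftrightarrow> holds s xs e \<or> holds t xs e"
  "holds (TMul s t) xs e \<longleftrightarrow> holds s xs e \<and> holds t xs e"
  "holds (tNot t) xs e \<longleftrightarrow> \<not> holds t xs e"
  "holds (tEq s t) xs e \<longleftrightarrow> teval s xs e = teval t xs e"
  "holds (tLe s t) xs e \<longleftrightarrow> teval s xs e \<le> teval t xs e"
  "holds (tXor s t) xs e \<longleftrightarrow> holds s xs e \<noteq> holds t xs e"
  "holds (TSum x s t) xs e \<longleftrightarrow> (\<exists>a<teval s xs e. holds t xs (e(x := a)))"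
  by (auto simp: holds_def tNot_def tEq_def tLe_def tXor_def)

lemma holds_tOrs [simp]: "holds (tOrs ts) xs e \<longleftrightarrow> (\<exists>t \<in> set ts. holds t xs e)"
  by (induction ts) (simp_all add: tOrs_def)

lemma teval_tNot_tNot: "teval (tNot (tNot t)) xs e = of_bool (holds t xs e)"
  by (simp add: tNot_def holds_def)

section \<open>Terms for the output word\<close>

definition size_term :: tm where
  "size_term = TIn (TC 0)"

definition tEx :: "nat \<Rightarrow> tm \<Rightarrow> tm" where
  "tEx x t = TSum x size_term t"

text \<open>Here and in the next two terms, the summand 1 skips the leading vertex count of the
  encoding.\<close>

definition edge_term :: "nat \<Rightarrow> nat \<Rightarrow> tm" where
  "edge_term x y = TIn (TAdd (TC 1) (TAdd (TMul (TV x) size_term) (TV y)))"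

definition part_term :: "nat \<Rightarrow> nat \<Rightarrow> tm" where
  "part_term i x = TIn (TAdd (TC 1) (TAdd (TMul size_term size_term)
     (TAdd (TMul (TC (i - 1)) size_term) (TV x))))"

definition order_term :: "nat \<Rightarrow> nat \<Rightarrow> nat \<Rightarrow> nat \<Rightarrow> nat \<Rightarrow> tm" where
  "order_term k i j x y = TIn (TAdd (TC 1) (TAdd (TMul size_term size_term) (TAdd (TMul (TC k) size_term)
     (TAdd (TMul (TC (pair_index k i j)) (TMul size_term size_term))
       (TAdd (TMul (TV x) size_term) (TV y))))))"

definition distinct_term :: "nat \<Rightarrow> nat \<Rightarrow> tm" where
  "distinct_term x y = tNot (tEq (TV x) (TV y))"

definition sides_term :: "nat \<Rightarrow> nat \<Rightarrow> nat \<Rightarrow> nat \<Rightarrow> nat \<Rightarrow> tm" where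
  "sides_term i j x y z = TAdd (TMul (part_term i x) (TMul (part_term i y) (part_term j z)))
     (TMul (part_term j x) (TMul (part_term j y) (part_term i z)))"

text \<open>A triple that refutes (b) or (c) for \<open>E\<close>. Variables 11 to 13 are reserved
  for it; 0 is the output position, 1 and 2 are elements of the poset, 5 and 6 their vertices, and 7
  is the intermediate vertex of \<open>ord\<close>.\<close>

definition violation_term :: "nat \<Rightarrow> nat \<Rightarrow> nat \<Rightarrow> tm" where
  "violation_term k i j = TMul (distinct_term 11 12) (TMul (order_term k i j 11 12)
     (TMul (distinct_term 12 13) (TMul (order_term k i j 12 13) (TMul (edge_term 11 13)
       (TAdd (TMul (sides_term i j 11 12 13) (tNot (edge_term 12 13)))
             (TMul (sides_term i j 12 13 11) (tNot (edge_term 11 12))))))))"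

definition fits_term :: "nat \<Rightarrow> nat \<Rightarrow> nat \<Rightarrow> tm" where
  "fits_term k i j = tNot (tEx 11 (tEx 12 (tEx 13 (violation_term k i j))))"

definition apart_term :: "nat \<Rightarrow> nat \<Rightarrow> nat \<Rightarrow> nat \<Rightarrow> nat \<Rightarrow> tm" where
  "apart_term k i j x y = tXor (edge_term x y) (fits_term k i j)"

definition base_term :: "nat \<Rightarrow> nat \<Rightarrow> nat \<Rightarrow> nat \<Rightarrow> nat \<Rightarrow> tm" where
  "base_term k c d x y = tOrs (map (\<lambda>i. TMul (part_term i x) (TMul (part_term i y)
     (TMul (order_term k i i x y)
        (if c = 1 \<and> d = 0 then TMul (distinct_term x y) (apart_term k i i x y) else TC 1)))) [1..<Suc k])"

definition inside_term :: "nat \<times> nat \<Rightarrow> nat \<Rightarrow> tm" where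
  "inside_term p x = (case p of (i, j) \<Rightarrow> TAdd (part_term i x) (part_term j x))"

definition cross_term :: "nat \<Rightarrow> nat \<times> nat \<Rightarrow> nat \<Rightarrow> nat \<Rightarrow> tm" where
  "cross_term k p x y = (case p of (i, j) \<Rightarrow>
     TAdd (TMul (inside_term p x) (TMul (inside_term p y) (TMul (order_term k i j x y)
             (TAdd (tNot (tXor (part_term i x) (part_term i y))) (apart_term k i j x y)))))
          (TMul (tNot (inside_term p x)) (TMul (tNot (inside_term p y)) (tLe (TV x) (TV y)))))"

text \<open>Block numbers, and with them the pairs of parts, are constants of the program, so the
  case distinctions are made outside of the term; only vertices are run-time values.\<close>

definition ord_term :: "nat \<Rightarrow> nat \<Rightarrow> nat \<Rightarrow> tm" where
  "ord_term k c d =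
     (if c < 2 then
        if d < 2 then base_term k c d 5 6
        else tEx 7 (TMul (inside_term (pairs k ! (d - 2)) 7)
               (TMul (base_term k c 0 5 7) (cross_term k (pairs k ! (d - 2)) 7 6)))
      else if c = d then cross_term k (pairs k ! (c - 2)) 5 6 else TC 0)"

definition element_term :: "nat \<Rightarrow> nat \<Rightarrow> tm" where
  "element_term c x = TAdd (TMul (TC c) size_term) (TV x)"

text \<open>Without division, an element number is decoded by trying every block and searching for
  the vertex.\<close>

definition relation_term :: "nat \<Rightarrow> tm" where
  "relation_term k = tOrs (map (\<lambda>c. tOrs (map (\<lambda>d. tEx 5 (tEx 6
     (TMul (tEq (TV 1) (element_term c 5)) (TMul (tEq (TV 2) (element_term d 6)) (ord_term k c d)))))
     [0..<num_blocks k])) [0..<num_blocks k])"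

definition mark_term :: "nat \<Rightarrow> nat \<Rightarrow> tm" where
  "mark_term k t =
     (if t < num_blocks k then tEx 5 (tEq (TV 1) (element_term t 5))
      else if t < num_blocks k + k then
        tEx 5 (TMul (part_term (t - num_blocks k + 1) 5)
          (tOrs (map (\<lambda>c. tEq (TV 1) (element_term c 5)) [0..<num_blocks k])))
      else let i = (t - num_blocks k - k) div (k + 1); j = (t - num_blocks k - k) mod (k + 1)
        in if 1 \<le> i \<and> i \<le> j \<and> j \<le> k then fits_term k i j else TC 0)"

definition card_term :: "nat \<Rightarrow> tm" where
  "card_term k = TMul (TC (num_blocks k)) size_term"

definition length_term :: "nat \<Rightarrow> tm" where
  "length_term k = TAdd (TC 1) (TAdd (TMul (card_term k) (card_term k))
     (TMul (TC (num_marks (thin_transduction k))) (card_term k)))"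

definition bit_term :: "nat \<Rightarrow> tm" where
  "bit_term k = TAdd
     (TSum 1 (card_term k) (TSum 2 (card_term k) (TMul
        (tEq (TV 0) (TAdd (TC 1) (TAdd (TMul (TV 1) (card_term k)) (TV 2)))) (relation_term k))))
     (tOrs (map (\<lambda>t. TSum 1 (card_term k) (TMul
        (tEq (TV 0) (TAdd (TC 1) (TAdd (TMul (card_term k) (card_term k))
           (TAdd (TMul (TC t) (card_term k)) (TV 1))))) (mark_term k t)))
        [0..<num_marks (thin_transduction k)]))"

text \<open>\<open>tNot (TV 0)\<close> is 1 at position 0 only, where it contributes the leading
  number of elements.\<close>

definition entry_term :: "nat \<Rightarrow> tm" where
  "entry_term k = TAdd (TMul (tNot (TV 0)) (card_term k)) (tNot (tNot (bit_term k)))"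

section \<open>Correctness of the terms on encoded instances\<close>

locale thin_instance =
  fixes k n :: nat and E P L
  assumes simple: "simple_graph {..<n} E" and thin: "mixed_thin_witness k {..<n} E P L"

text \<open>For the order \<open>W\<close> of the vertices outside of a pair the algorithm uses the
  order of the numbers, which \<open>tLe\<close> can test.\<close>

sublocale thin_instance \<subseteq> mixed_thin k "{..<n}" E P L "{(u, v). u \<le> v \<and> v < n}"
proof unfold_locales
  show "linear_order_on {..<n} {(u, v). u \<le> v \<and> v < n}"
    by (auto simp: linear_order_on_def partial_order_on_def preorder_on_def refl_on_def trans_def
        antisym_def total_on_def)
qed (fact simple thin)+

context thin_instance
begin

abbreviation input :: "nat list" where
  "input \<equiv> encode_instance k n E P L"

lemma teval_size: "teval size_term input e = n"
  by (simp add: size_term_def nth_encode_size length_encode_instance)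

lemma holds_tEx:
  "(\<And>a. a < n \<Longrightarrow> holds t input (e(x := a)) \<longleftrightarrow> Q a) \<Longrightarrow> holds (tEx x t) input e \<longleftrightarrow> (\<exists>a<n. Q a)"
  unfolding tEx_def holds_simps teval_size by blast

lemma holds_edge: "e x < n \<Longrightarrow> e y < n \<Longrightarrow> holds (edge_term x y) input e \<longleftrightarrow> {e x, e y} \<in> E"
  using nth_encode_edge[of "e x" n "e y" k E P L] mult_add_less[of "e x" n "e y" n]
  by (simp add: holds_def edge_term_def teval_size length_encode_instance)

lemma holds_part:
  assumes "i \<in> {1..k}" "e x < n"
  shows "holds (part_term i x) input e \<longleftrightarrow> e x \<in> P i"
proof -
  have "(i - 1) * n + e x < k * n" using assms by (intro mult_add_less) auto
  then show ?thesis
    using nth_encode_part[OF assms(1), of "e x" n E P L] assms(2)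
    by (simp add: holds_def part_term_def teval_size length_encode_instance add.assoc)
qed

lemma holds_order:
  assumes "1 \<le> i" "i \<le> j" "j \<le> k" "e x < n" "e y < n"
  shows "holds (order_term k i j x y) input e \<longleftrightarrow> (e x, e y) \<in> L i j"
proof -
  have "pair_index k i j * (n * n) + (e x * n + e y) < length (all_pairs k) * (n * n)"
    by (rule mult_add_less[OF pair_index(1)[OF assms(1-3)] mult_add_less[OF assms(4,5)]])
  then show ?thesis
    using nth_encode_order[OF assms, of E P L]
    by (simp add: holds_def order_term_def teval_size length_encode_instance add.assoc)
qed

lemma holds_distinct: "holds (distinct_term x y) input e \<longleftrightarrow> e x \<noteq> e y"
  by (simp add: distinct_term_def)

lemma holds_fits:
  assumes "1 \<le> i" "i \<le> j" "j \<le> k"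
  shows "holds (fits_term k i j) input e \<longleftrightarrow> flag i j"
proof -
  have ij: "i \<in> {1..k}" "j \<in> {1..k}" using assms by auto
  define bad where "bad u v w \<longleftrightarrow> u \<noteq> v \<and> (u, v) \<in> L i j \<and> v \<noteq> w \<and> (v, w) \<in> L i j \<and> {u, w} \<in> E \<and>
     ((u \<in> P i \<and> v \<in> P i \<and> w \<in> P j \<or> u \<in> P j \<and> v \<in> P j \<and> w \<in> P i) \<and> {v, w} \<notin> E \<or>
      (v \<in> P i \<and> w \<in> P i \<and> u \<in> P j \<or> v \<in> P j \<and> w \<in> P j \<and> u \<in> P i) \<and> {u, v} \<notin> E)" for u v w
  have "holds (violation_term k i j) input (e(11 := u, 12 := v, 13 := w)) \<longleftrightarrow> bad u v w"
    if "u < n" "v < n" "w < n" for u v w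
    unfolding violation_term_def sides_term_def bad_def using that
    by (simp add: holds_distinct holds_edge holds_part[OF ij(1)] holds_part[OF ij(2)] holds_order[OF assms])
  then have "holds (tEx 11 (tEx 12 (tEx 13 (violation_term k i j)))) input e \<longleftrightarrow> (\<exists>u<n. \<exists>v<n. \<exists>w<n. bad u v w)"
    by (intro holds_tEx)
  also have "\<dots> \<longleftrightarrow> \<not> flag i j"
  proof -
    have sub: "P i \<subseteq> {..<n}" "P j \<subseteq> {..<n}" using part_subset ij by blast+
    \<comment> \<open>A violating triple lies in the two parts, so bounding the search by
      \<open>n\<close> loses nothing.\<close>
    have "(\<exists>u<n. \<exists>v<n. \<exists>w<n. bad u v w) \<longleftrightarrow> (\<exists>u v w. bad u v w)"
      using sub unfolding bad_def by blast
    also have "\<dots> \<longleftrightarrow> \<not> flag i j"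
      unfolding flag_def fits_def bad_def by blast
    finally show ?thesis .
  qed
  finally show ?thesis by (simp add: fits_term_def)
qed

lemma holds_apart:
  "1 \<le> i \<Longrightarrow> i \<le> j \<Longrightarrow> j \<le> k \<Longrightarrow> e x < n \<Longrightarrow> e y < n \<Longrightarrow>
     holds (apart_term k i j x y) input e \<longleftrightarrow> apart i j (e x) (e y)"
  by (simp add: apart_term_def apart_def holds_edge holds_fits)

lemma holds_base:
  assumes "e x < n" "e y < n"
  shows "holds (base_term k c d x y) input e \<longleftrightarrow> base c d (e x) (e y)"
proof -
  have set: "set [1..<Suc k] = {1..k}" by auto
  have "holds (TMul (part_term i x) (TMul (part_term i y) (TMul (order_term k i i x y)
        (if c = 1 \<and> d = 0 then TMul (distinct_term x y) (apart_term k i i x y) else TC 1)))) input e \<longleftrightarrow>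
      e x \<in> P i \<and> e y \<in> P i \<and> (e x, e y) \<in> L i i \<and> (c = 1 \<and> d = 0 \<longrightarrow> e x \<noteq> e y \<and> apart i i (e x) (e y))"
    if "i \<in> {1..k}" for i
    using that assms by (auto simp: holds_part holds_order holds_distinct holds_apart)
  then have "holds (base_term k c d x y) input e \<longleftrightarrow> (\<exists>i \<in> {1..k}. e x \<in> P i \<and> e y \<in> P i \<and> (e x, e y) \<in> L i i \<and>
      (c = 1 \<and> d = 0 \<longrightarrow> e x \<noteq> e y \<and> apart i i (e x) (e y)))"
    unfolding base_term_def holds_tOrs set_map set by simp
  then show ?thesis by (cases "c = 1 \<and> d = 0") (auto simp: base_def below_def far_below_def)
qed

lemma holds_inside:
  "1 \<le> i \<Longrightarrow> i \<le> j \<Longrightarrow> j \<le> k \<Longrightarrow> e x < n \<Longrightarrow> holds (inside_term (i, j) x) input e \<longleftrightarrow> e x \<in> inside (i, j)"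
  by (simp add: inside_term_def inside_def holds_part)

lemma holds_cross:
  assumes "1 \<le> i" "i \<le> j" "j \<le> k" "e x < n" "e y < n"
  shows "holds (cross_term k (i, j) x y) input e \<longleftrightarrow> cross (i, j) (e x) (e y)"
  using assms holds_inside[OF assms(1-3), of e x] holds_inside[OF assms(1-3), of e y]
  by (auto simp: cross_term_def cross_def holds_part holds_order holds_apart inside_def)

lemma holds_ord:
  assumes "e 5 < n" "e 6 < n" "c < num_blocks k" "d < num_blocks k"
  shows "holds (ord_term k c d) input e \<longleftrightarrow> ord c d (e 5) (e 6)"
proof -
  consider "c < 2" "d < 2" | "c < 2" "2 \<le> d" | "2 \<le> c" by linarith
  then show ?thesis
  proof cases
    case 1
    then show ?thesis using assms by (simp add: ord_term_def ord_def holds_base)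
  next
    case 2
    from 2(2) assms(4) obtain i j where p: "pairs k ! (d - 2) = (i, j)" "1 \<le> i" "i < j" "j \<le> k"
      by (rule block_pair)
    then have ij: "1 \<le> i" "i \<le> j" "j \<le> k" by auto
    have "holds (ord_term k c d) input e \<longleftrightarrow> (\<exists>w<n. w \<in> inside (i, j) \<and> base c 0 (e 5) w \<and> cross (i, j) w (e 6))"
      using 2 p(1) assms ij
      by (simp add: ord_term_def) (intro holds_tEx, simp add: holds_inside holds_base holds_cross)
    moreover have "inside (i, j) \<subseteq> {..<n}"
      using part_subset[of i] part_subset[of j] ij by (auto simp: inside_def)
    ultimately show ?thesis using 2 p(1) by (auto simp: ord_def)
  next
    case 3
    from 3 assms(3) obtain i j where p: "pairs k ! (c - 2) = (i, j)" "1 \<le> i" "i < j" "j \<le> k"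
      by (rule block_pair)
    then show ?thesis using 3 assms by (cases "c = d") (simp_all add: ord_term_def ord_def holds_cross)
  qed
qed

text \<open>Block 0 keeps the numbers of its vertices, as \<open>image_poset\<close>
  demands.\<close>

definition number :: "nat \<times> nat \<Rightarrow> nat" where
  "number x = fst x * n + snd x"

lemma inj_number: "inj_on number elems"
proof (rule inj_onI)
  fix x y assume xy: "x \<in> elems" "y \<in> elems" "number x = number y"
  then have n: "snd x < n" "snd y < n" by (auto simp: elems_def)
  then have "number x div n = fst x" "number x mod n = snd x"
    "number y div n = fst y" "number y mod n = snd y" by (auto simp: number_def)
  then show "x = y" using xy(3) by (simp add: prod_eq_iff)
qed

lemma number_elems: "number ` elems = {..<num_blocks k * n}"
proof (intro equalityI subsetI)
  fix a assume "a \<in> number ` elems"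
  then show "a \<in> {..<num_blocks k * n}" by (auto simp: number_def elems_def intro: mult_add_less)
next
  fix a assume a: "a \<in> {..<num_blocks k * n}"
  then have "0 < n" by (cases "n = 0") auto
  then have "(a div n, a mod n) \<in> elems" using a by (simp add: elems_def less_mult_imp_div_less)
  moreover have "a = number (a div n, a mod n)" by (simp add: number_def)
  ultimately show "a \<in> number ` elems" by blast
qed

lemma holds_relation: "holds (relation_term k) input e \<longleftrightarrow> (e 1, e 2) \<in> map_prod number number ` order"
proof -
  have "holds (relation_term k) input e \<longleftrightarrow> (\<exists>c<num_blocks k. \<exists>d<num_blocks k. \<exists>u<n. \<exists>v<n.
      e 1 = c * n + u \<and> e 2 = d * n + v \<and> ord c d u v)"
  proof -
    have set: "set [0..<num_blocks k] = {..<num_blocks k}" by auto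
    have *: "holds (tEx 5 (tEx 6 (TMul (tEq (TV 1) (element_term c 5))
          (TMul (tEq (TV 2) (element_term d 6)) (ord_term k c d))))) input e \<longleftrightarrow>
        (\<exists>u<n. \<exists>v<n. e 1 = c * n + u \<and> e 2 = d * n + v \<and> ord c d u v)"
      if "c < num_blocks k" "d < num_blocks k" for c d
      using that by (intro holds_tEx) (simp add: element_term_def teval_size holds_ord)
    show ?thesis
      unfolding relation_term_def holds_tOrs set_map set using *
      by (simp add: atLeast0LessThan Bex_def)
  qed
  also have "\<dots> \<longleftrightarrow> (e 1, e 2) \<in> map_prod number number ` order"
    by (force simp: order_def elems_def number_def image_iff)
  finally show ?thesis .
qed

text \<open>The terms for flags do not look at the element at all, so they agree with the marks only
  on numbers of actual elements.\<close>

lemma holds_mark: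
  assumes "e 1 < num_blocks k * n"
  shows "holds (mark_term k t) input e \<longleftrightarrow> e 1 \<in> number ` marks t"
proof -
  consider "t < num_blocks k" | "num_blocks k \<le> t" "t < num_blocks k + k" | "num_blocks k + k \<le> t"
    by linarith
  then show ?thesis
  proof cases
    case 1
    have "holds (tEx 5 (tEq (TV 1) (element_term t 5))) input e \<longleftrightarrow> (\<exists>u<n. e 1 = t * n + u)"
      by (intro holds_tEx) (simp add: element_term_def teval_size)
    then show ?thesis using 1 by (force simp: mark_term_def marks_def number_def image_iff)
  next
    case 2
    let ?i = "t - num_blocks k + 1"
    have i: "?i \<in> {1..k}" using 2 by auto
    have "holds (tEx 5 (TMul (part_term ?i 5)
          (tOrs (map (\<lambda>c. tEq (TV 1) (element_term c 5)) [0..<num_blocks k])))) input e \<longleftrightarrow>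
        (\<exists>u<n. u \<in> P ?i \<and> (\<exists>c \<in> {..<num_blocks k}. e 1 = c * n + u))"
      by (intro holds_tEx) (simp add: element_term_def teval_size holds_part[OF i] atLeast0LessThan del: One_nat_def)
    moreover have "P ?i \<subseteq> {..<n}" using part_subset[OF i] .
    ultimately show ?thesis using 2 by (force simp: mark_term_def marks_def number_def image_iff)
  next
    case 3
    have "number ` elems = {..<num_blocks k * n}" by (rule number_elems)
    then show ?thesis using 3 assms by (auto simp: mark_term_def marks_def Let_def holds_fits)
  qed
qed

lemma teval_card: "teval (card_term k) input e = num_blocks k * n"
  by (simp add: card_term_def teval_size)

theorem tabulate_encode:
  "tabulate (length_term k) (entry_term k) input =
     encode_marked_poset (num_marks (thin_transduction k)) (num_blocks k * n)
       (map_prod number number ` order) (\<lambda>t. number ` marks t)"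
    (is "_ = encode_marked_poset ?q ?m ?r ?M")
proof (rule nth_equalityI)
  have len: "teval (length_term k) input e = 1 + ?m * ?m + ?q * ?m" for e
    by (simp add: length_term_def teval_card)
  show len': "length (tabulate (length_term k) (entry_term k) input) = length (encode_marked_poset ?q ?m ?r ?M)"
    by (simp only: tabulate_def length_map length_upt len length_encode_marked_poset)
  fix i assume "i < length (tabulate (length_term k) (entry_term k) input)"
  then have i: "i < 1 + ?m * ?m + ?q * ?m" by (simp only: len' length_encode_marked_poset)
  let ?e = "(\<lambda>_::nat. 0::nat)(0 := i)"
  have rel: "holds (TSum 1 (card_term k) (TSum 2 (card_term k) (TMul
        (tEq (TV 0) (TAdd (TC 1) (TAdd (TMul (TV 1) (card_term k)) (TV 2)))) (relation_term k)))) input ?e \<longleftrightarrow>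
      (\<exists>a<?m. \<exists>b<?m. i = 1 + a * ?m + b \<and> (a, b) \<in> ?r)"
    by (simp add: teval_card holds_relation)
  have mark: "holds (TSum 1 (card_term k) (TMul
        (tEq (TV 0) (TAdd (TC 1) (TAdd (TMul (card_term k) (card_term k))
           (TAdd (TMul (TC t) (card_term k)) (TV 1))))) (mark_term k t))) input ?e \<longleftrightarrow>
      (\<exists>a<?m. i = 1 + ?m * ?m + t * ?m + a \<and> a \<in> ?M t)" for t
    unfolding holds_simps teval_card using holds_mark[of "?e(1 := _)" t] by (auto simp: teval_card)
  have set: "set [0..<?q] = {..<?q}" by auto
  have bit: "holds (bit_term k) input ?e \<longleftrightarrow> (\<exists>a<?m. \<exists>b<?m. i = 1 + a * ?m + b \<and> (a, b) \<in> ?r) \<or>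
      (\<exists>t<?q. \<exists>a<?m. i = 1 + ?m * ?m + t * ?m + a \<and> a \<in> ?M t)"
    unfolding bit_term_def holds_simps(2) rel holds_tOrs set_map set by (simp only: bex_simps mark) blast
  have "tabulate (length_term k) (entry_term k) input ! i = teval (entry_term k) input ?e"
    unfolding tabulate_def len using i by (simp add: nth_upt del: upt_Suc)
  also have "\<dots> = (if i = 0 then ?m else of_bool (holds (bit_term k) input ?e))"
  proof -
    have "teval (entry_term k) input ?e = (1 - i) * ?m + of_bool (holds (bit_term k) input ?e)"
      unfolding entry_term_def teval.simps teval_tNot_tNot teval_card by (simp add: tNot_def)
    \<comment> \<open>All bits sit at positions of the form \<open>1 + ...\<close>, so none
      interferes with the leading entry.\<close>
    moreover have "\<not> holds (bit_term k) input ?e" if "i = 0" unfolding bit using that by simp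
    ultimately show ?thesis by simp
  qed
  finally show "tabulate (length_term k) (entry_term k) input ! i = encode_marked_poset ?q ?m ?r ?M ! i"
    unfolding bit nth_encode_marked_poset[OF i] .
qed

end

theorem theorem5p1:
  fixes k :: nat
  assumes "k \<ge> 1"
  shows "\<exists>T :: (unit, unit) transduction.
    is_transduction binary_signature binary_signature T \<and>
    (mixed_thin_graphs k :: (unit, 'a :: infinite) rel_structure set)
      \<subseteq> transduce_class binary_signature T (posets_of_width_at_most (5 * (k choose 2) + 2 * k)) \<and>
    (\<exists>f. poly_time_computable_on (mixed_thin_instances k) f \<and>
      (\<forall>n E P L. simple_graph {..<n} E \<and> mixed_thin_witness k {..<n} E P L \<longrightarrow>
        (\<exists>m r M. f (encode_instance k n E P L) = encode_marked_poset (num_marks T) m r M \<and>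
          finite_poset {..<m} r \<and>
          poset_width {..<m} r \<le> 5 * (k choose 2) + 2 * k \<and>
          is_marking T (poset_structure {..<m} r) M \<and>
          transduce_marked binary_signature T (poset_structure {..<m} r) M
            = graph_structure {..<n} E)))"
proof (intro exI conjI allI impI)
  show "is_transduction binary_signature binary_signature (thin_transduction k)"
    by (rule is_transduction_thin)
  show "(mixed_thin_graphs k :: (unit, 'a) rel_structure set) \<subseteq> transduce_class binary_signature
      (thin_transduction k) (posets_of_width_at_most (5 * (k choose 2) + 2 * k))"
    by (rule mixed_thin_graphs_transduction)
  show "poly_time_computable_on (mixed_thin_instances k) (tabulate (length_term k) (entry_term k))"
    by (rule poly_time_tabulate) (auto simp: mixed_thin_instances_def intro: encode_instance_entries)
  fix n :: nat and E P L assume "simple_graph {..<n} E \<and> mixed_thin_witness k {..<n} E P L"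
  then interpret thin_instance k n E P L by unfold_locales simp_all
  have "\<forall>v \<in> {..<n}. number (0, v) = v" by (simp add: number_def)
  note image = image_poset[OF inj_number this, unfolded number_elems]
  let ?m = "num_blocks k * n" and ?r = "map_prod number number ` order" and ?M = "\<lambda>t. number ` marks t"
  show "tabulate (length_term k) (entry_term k) (encode_instance k n E P L) =
      encode_marked_poset (num_marks (thin_transduction k)) ?m ?r ?M"
    by (rule tabulate_encode)
  show "finite_poset {..<?m} ?r" "poset_width {..<?m} ?r \<le> 5 * (k choose 2) + 2 * k"
    "is_marking (thin_transduction k) (poset_structure {..<?m} ?r) ?M"
    "transduce_marked binary_signature (thin_transduction k) (poset_structure {..<?m} ?r) ?M
       = graph_structure {..<n} E"
    by (fact image)+
qed

end
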